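(* Let $\lambda<\frac{3}{\sqrt{2}}$ be a real number and let $\Delta$ be a positive integer. Let $G$ be a connected graph with at least two vertices, let $\lambda_2(G)$ be the second largest eigenvalue (counted with multiplicity) of its adjacency matrix, and let $m_{\lambda_2(G)}$ be the multiplicity of $\lambda_2(G)$ as an eigenvalue of the adjacency matrix of $G$. If $\lambda_2(G)\leq\lambda$ and the maximum degree of $G$ does not exceed $\Delta$, then $$m_{\lambda_2(G)}\leq 2n_{\lambda}\Delta^{n_{\lambda}+3}\left(1+\Delta+\Delta^2\right),$$ where $n_\lambda$ is the constant, depending only on $\lambda$, defined as the smallest positive integer $n$ such that $\lambda_1(\mathcal{T}(n,n,n))>\lambda$.
   Context: All graphs are finite, simple and undirected. The eigenvalues of the adjacency matrix of a graph $G$ with vertex set $V$ are listed with multiplicity as $\lambda_1(G)\geq\lambda_2(G)\geq\cdots\geq\lambda_{|V|}(G)$. For positive integers $p,q,\ell$, $\mathcal{T}(p,q,\ell)$ denotes the graph consisting of three paths of lengths $\ell$, $p$ and $q$ (length = number of edges), where the three paths share exactly their initial vertex. It is known that $\lambda_1(\mathcal{T}(n,n,n))$ is strictly increasing in $n$ with limit $\frac{3}{\sqrt{2}}$, so that $n_\lambda$ is well defined for every $\lambda<\frac{3}{\sqrt{2}}$. *)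

theory Defs
  imports "Graph_Theory.Graph_Theory" "Jordan_Normal_Form.Char_Poly"
begin

text \<open>
  A finite simple undirected graph is a digraph satisfying \<^locale>\<open>pair_graph\<close>: an edge
  between \<open>u\<close> and \<open>v\<close> is represented by the two arcs \<open>(u, v)\<close> and \<open>(v, u)\<close>, so the degree of
  a vertex is its out-degree.
\<close>

definition max_degree :: "'a pair_pre_digraph \<Rightarrow> nat" where
  "max_degree G = Max (out_degree (with_proj G) ` pverts G)"

text \<open>
  Matrices are indexed by natural numbers, hence the choice of an enumeration of the vertices.
  Another enumeration conjugates the adjacency matrix by a permutation matrix, so the
  characteristic polynomial does not depend on the choice.
\<close>

definition vertex_list :: "'a pair_pre_digraph \<Rightarrow> 'a list" where
  "vertex_list G = (SOME vs. distinct vs \<and> set vs = pverts G)"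

definition adjacency_matrix :: "'a pair_pre_digraph \<Rightarrow> real mat" where
  "adjacency_matrix G = (let vs = vertex_list G in
     mat (length vs) (length vs) (\<lambda>(i, j). if (vs ! i, vs ! j) \<in> parcs G then 1 else 0))"

text \<open>
  All eigenvalues of the adjacency matrix are real since it is symmetric, so the multiset of real
  roots of its characteristic polynomial has exactly \<open>card (pverts G)\<close> elements. They are listed
  in non-increasing order; \<open>graph_eigenvalue G k\<close> is $\lambda_k(G)$, with \<open>k\<close> counted from 1.
\<close>

definition graph_eigenvalues :: "'a pair_pre_digraph \<Rightarrow> real list" where
  "graph_eigenvalues G = rev (sorted_list_of_multiset (proots (char_poly (adjacency_matrix G))))"

definition graph_eigenvalue :: "'a pair_pre_digraph \<Rightarrow> nat \<Rightarrow> real" where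
  "graph_eigenvalue G k = graph_eigenvalues G ! (k - 1)"

definition eigenvalue_multiplicity :: "'a pair_pre_digraph \<Rightarrow> real \<Rightarrow> nat" where
  "eigenvalue_multiplicity G x = Polynomial.order x (char_poly (adjacency_matrix G))"

text \<open>
  \<open>three_paths p q l\<close> is $\mathcal{T}(p,q,\ell)$. Vertex \<open>j\<close> of path \<open>i\<close>
  (\<open>i = 0, 1, 2\<close>) is \<open>path_vertex i j\<close>, and the three initial vertices are identified.
\<close>

definition path_vertex :: "nat \<Rightarrow> nat \<Rightarrow> nat \<times> nat" where
  "path_vertex i j = (if j = 0 then (0, 0) else (i, j))"

definition three_paths :: "nat \<Rightarrow> nat \<Rightarrow> nat \<Rightarrow> (nat \<times> nat) pair_pre_digraph" where
  "three_paths p q l = (let len = (\<lambda>i. [l, p, q] ! i) in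
     \<lparr> pverts = {path_vertex i j | i j. i < 3 \<and> j \<le> len i},
       parcs = {(path_vertex i j, path_vertex i (Suc j)) | i j. i < 3 \<and> j < len i}
             \<union> {(path_vertex i (Suc j), path_vertex i j) | i j. i < 3 \<and> j < len i} \<rparr>)"

definition n_lambda :: "real \<Rightarrow> nat" where
  "n_lambda x = (LEAST n. 0 < n \<and> graph_eigenvalue (three_paths n n n) 1 > x)"

end

theory Submission
  imports Defs "HOL-Analysis.Function_Topology"
begin

text \<open>
  Let \<open>\<mu>\<close> be the second eigenvalue of \<open>G\<close>. The idea is to find a small set \<open>S\<close> of vertices
  whose deletion leaves a graph with largest eigenvalue at most \<open>\<mu>\<close>. An eigenvector for \<open>\<mu>\<close> that
  vanishes on \<open>S\<close> and on the neighbours of \<open>S\<close> is then zero: its absolute value maximises the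
  quadratic form of \<open>G - S\<close>, so, as in the Perron-Frobenius theorem, its zeros spread along arcs.
  Hence the multiplicity is at most the number of vertices of \<open>S\<close> and its neighbours
  (\<open>multiplicity_le_card\<close>).

  To find \<open>S\<close>, note that two parts of \<open>G\<close> that are disjoint and joined by no arc cannot both have
  largest eigenvalue above \<open>\<mu>\<close>, since otherwise \<open>G\<close> would have two eigenvalues above \<open>\<mu>\<close>
  (\<open>form_le_separated_cases\<close>). Let \<open>n\<close> be \<open>n_lambda lam\<close>. The spider \<open>T(n, n, n)\<close> has largest
  eigenvalue above \<open>lam\<close>, and the minimum defining \<open>n\<close> exists because a geometrically decaying
  test vector shows that these eigenvalues get arbitrarily close to \<open>3 / sqrt 2\<close>
  (\<open>three_paths_eigenvalue_exceeds\<close>).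

  If \<open>G\<close> contains the spider as a subgraph, \<open>S\<close> consists of its vertices and their neighbours, and
  its size is of order \<open>n * \<Delta>\<close>.

  If \<open>G\<close> does not contain the spider, every layer of vertices at a given distance from a root has at
  most \<open>2 * \<Delta> ^ n\<close> elements: three vertices of a layer whose shortest paths to the root stay
  apart for \<open>n\<close> steps would give three long legs (\<open>three_branches_embedding\<close>, \<open>card_layer_le\<close>).
  Grow a ball around the root. At the first radius at which its largest eigenvalue exceeds \<open>\<mu>\<close>, the
  part of \<open>G\<close> not adjacent to the ball has largest eigenvalue at most \<open>\<mu>\<close>, and so has the
  previous ball; the two layers between them form \<open>S\<close>.

  Largest eigenvalues of induced subgraphs appear as bounds on the quadratic form of vectors
  supported on a set of vertices. The spectral theorem for symmetric kernels
  (\<open>eigenbasis_exists\<close>) links these bounds to the roots of the characteristic polynomial.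
\<close>

section \<open>The spectral theorem for symmetric kernels\<close>

text \<open>
  The only dimension count of the development: it produces vectors orthogonal to given ones, and
  combinations of eigenvectors that vanish on a prescribed set of vertices.
\<close>

lemma homogeneous_system_solution:
  fixes c :: "'j \<Rightarrow> 'i \<Rightarrow> real"
  assumes "finite J" and "finite I" and "card J < card I"
  shows "\<exists>x. (\<exists>i\<in>I. x i \<noteq> 0) \<and> (\<forall>j\<in>J. (\<Sum>i\<in>I. c j i * x i) = 0)"
  using assms
proof (induction J arbitrary: I c rule: finite_induct)
  case empty
  then have "I \<noteq> {}" by auto
  then show ?case by (intro exI[of _ "\<lambda>_. 1"]) auto
next
  case (insert j J)
  show ?case
  proof (cases "\<forall>i\<in>I. c j i = 0")
    case True
    have "card J < card I" using insert by simp
    from insert.IH[OF insert.prems(1) this, of c] True show ?thesis by auto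
  next
    case False
    then obtain i0 where i0: "i0 \<in> I" "c j i0 \<noteq> 0" by blast
    define I' where "I' = I - {i0}"
    have I': "finite I'" "card J < card I'" "i0 \<notin> I'" "I = insert i0 I'"
      using insert i0 by (auto simp: I'_def)
    \<comment> \<open>one elimination step: equation \<open>j\<close> is solved for the unknown \<open>i0\<close>\<close>
    from insert.IH[OF I'(1,2), of "\<lambda>k i. c k i - c k i0 * c j i / c j i0"]
    obtain x where x: "\<exists>i\<in>I'. x i \<noteq> 0"
      "\<And>k. k \<in> J \<Longrightarrow> (\<Sum>i\<in>I'. (c k i - c k i0 * c j i / c j i0) * x i) = 0" by blast
    define s where "s = (\<Sum>i\<in>I'. c j i * x i)"
    define y where "y = x(i0 := - s / c j i0)"
    have sum_y: "(\<Sum>i\<in>I. c k i * y i) = (\<Sum>i\<in>I'. c k i * x i) - c k i0 * s / c j i0" for k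
    proof -
      have "(\<Sum>i\<in>I'. c k i * y i) = (\<Sum>i\<in>I'. c k i * x i)"
        using I'(3) by (intro sum.cong) (auto simp: y_def)
      then show ?thesis using I' by (simp add: y_def)
    qed
    have "(\<Sum>i\<in>I. c k i * y i) = 0" if "k \<in> J" for k
    proof -
      have "(\<Sum>i\<in>I'. c k i * x i) - c k i0 / c j i0 * s
          = (\<Sum>i\<in>I'. (c k i - c k i0 * c j i / c j i0) * x i)"
        unfolding s_def sum_distrib_left sum_subtractf[symmetric]
        by (intro sum.cong) (auto simp: algebra_simps)
      with x(2)[OF that] show ?thesis unfolding sum_y by simp
    qed
    moreover have "(\<Sum>i\<in>I. c j i * y i) = 0"
      unfolding sum_y using i0(2) by (simp add: s_def)
    moreover have "\<exists>i\<in>I. y i \<noteq> 0" using x(1) I'(3,4) by (auto simp: y_def)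
    ultimately show ?thesis by (intro exI[of _ y]) auto
  qed
qed

lemma quadratic_nonpos_imp_linear_coeff_zero:
  fixes c e :: real
  assumes "\<And>t. 2 * t * c + t\<^sup>2 * e \<le> 0"
  shows "c = 0"
proof (rule ccontr)
  assume "c \<noteq> 0"
  \<comment> \<open>for small \<open>t\<close> the linear term dominates; \<open>t = c / m\<close> is small enough\<close>
  define m where "m = 1 + \<bar>e\<bar>"
  have m: "m > 0" "- e \<le> m" by (auto simp: m_def)
  have "2 * (c / m) * c + (c / m)\<^sup>2 * e = c\<^sup>2 / m\<^sup>2 * (2 * m + e)"
    using m by (simp add: field_simps power2_eq_square)
  moreover have "c\<^sup>2 / m\<^sup>2 * (2 * m + e) > 0"
    using m \<open>c \<noteq> 0\<close> by (intro mult_pos_pos divide_pos_pos) auto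
  ultimately show False using assms[of "c / m"] by linarith
qed

text \<open>
  Vectors indexed by \<open>V\<close> are functions on the whole type whose values outside \<open>V\<close> are
  irrelevant. This avoids choosing an order of the vertices until the matrix of the graph appears, and
  lets one vector be compared on different sets of vertices.
\<close>

locale symmetric_kernel =
  fixes V :: "'a set" and K :: "'a \<Rightarrow> 'a \<Rightarrow> real"
  assumes finite_V: "finite V"
    and symmetric_K: "K v w = K w v"
begin

definition dot :: "('a \<Rightarrow> real) \<Rightarrow> ('a \<Rightarrow> real) \<Rightarrow> real" where
  "dot x y = (\<Sum>v\<in>V. x v * y v)"

definition act :: "('a \<Rightarrow> real) \<Rightarrow> 'a \<Rightarrow> real" where
  "act x v = (\<Sum>w\<in>V. K v w * x w)"

lemma dot_commute: "dot x y = dot y x"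
  by (simp add: dot_def mult.commute)

lemma dot_add_left: "dot (\<lambda>v. x v + y v) z = dot x z + dot y z"
  by (simp add: dot_def algebra_simps sum.distrib)

lemma dot_scale_left: "dot (\<lambda>v. c * x v) z = c * dot x z"
  by (simp add: dot_def algebra_simps sum_distrib_left)

lemma dot_add_right: "dot z (\<lambda>v. x v + y v) = dot z x + dot z y"
  by (simp add: dot_def algebra_simps sum.distrib)

lemma dot_scale_right: "dot z (\<lambda>v. c * x v) = c * dot z x"
  by (simp add: dot_def algebra_simps sum_distrib_left)

lemma dot_sum_left: "dot (\<lambda>v. \<Sum>i\<in>I. f i v) z = (\<Sum>i\<in>I. dot (f i) z)"
  unfolding dot_def sum_distrib_right by (rule sum.swap)

lemma act_add: "act (\<lambda>v. x v + y v) = (\<lambda>v. act x v + act y v)"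
  by (simp add: act_def fun_eq_iff algebra_simps sum.distrib)

lemma act_scale: "act (\<lambda>v. c * x v) = (\<lambda>v. c * act x v)"
  by (simp add: act_def fun_eq_iff algebra_simps sum_distrib_left)

lemma act_sum: "act (\<lambda>v. \<Sum>i\<in>I. f i v) v = (\<Sum>i\<in>I. act (f i) v)"
  unfolding act_def sum_distrib_left by (rule sum.swap)

lemma dot_cong: "(\<And>v. v \<in> V \<Longrightarrow> x v = x' v) \<Longrightarrow> (\<And>v. v \<in> V \<Longrightarrow> y v = y' v) \<Longrightarrow> dot x y = dot x' y'"
  by (simp add: dot_def)

lemma act_cong: "(\<And>v. v \<in> V \<Longrightarrow> x v = x' v) \<Longrightarrow> act x = act x'"
  by (simp add: act_def fun_eq_iff)

lemma dot_act_symmetric: "dot x (act y) = dot (act x) y"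
proof -
  have "dot x (act y) = (\<Sum>v\<in>V. \<Sum>w\<in>V. x v * K v w * y w)"
    by (simp add: dot_def act_def sum_distrib_left mult.assoc)
  also have "\<dots> = (\<Sum>w\<in>V. \<Sum>v\<in>V. x v * K v w * y w)" by (rule sum.swap)
  also have "\<dots> = dot (act x) y"
    unfolding dot_def act_def sum_distrib_right
    by (intro sum.cong refl) (subst symmetric_K, simp add: mult.commute)
  finally show ?thesis .
qed

lemma dot_self_nonneg: "dot x x \<ge> 0"
  by (simp add: dot_def sum_nonneg)

lemma dot_self_eq_0_iff: "dot x x = 0 \<longleftrightarrow> (\<forall>v\<in>V. x v = 0)"
  unfolding dot_def using finite_V by (subst sum_nonneg_eq_0_iff) auto

lemma dot_self_pos: "v \<in> V \<Longrightarrow> x v \<noteq> 0 \<Longrightarrow> dot x x > 0"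
  using dot_self_nonneg[of x] dot_self_eq_0_iff[of x] by fastforce

text \<open>
  Along the line \<open>x + t y\<close> the difference of the two sides is a quadratic polynomial in \<open>t\<close>
  that has its maximum \<open>0\<close> at \<open>t = 0\<close>, so its linear coefficient vanishes. It is used twice: to
  turn Rayleigh maximisers into eigenvectors, and for the absolute value of an eigenvector.
\<close>

lemma maximiser_stationary:
  assumes bound: "\<And>t. dot (\<lambda>v. x v + t * y v) (act (\<lambda>v. x v + t * y v))
      \<le> \<mu> * dot (\<lambda>v. x v + t * y v) (\<lambda>v. x v + t * y v)"
    and attained: "dot x (act x) = \<mu> * dot x x"
  shows "dot y (act x) = \<mu> * dot y x"
proof -
  have "dot y (act x) - \<mu> * dot y x = 0"
  proof (rule quadratic_nonpos_imp_linear_coeff_zero[where e = "dot y (act y) - \<mu> * dot y y"])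
    fix t
    have "dot x (act y) = dot y (act x)"
      using dot_act_symmetric dot_commute by metis
    with bound[of t] attained
    show "2 * t * (dot y (act x) - \<mu> * dot y x) + t\<^sup>2 * (dot y (act y) - \<mu> * dot y y) \<le> 0"
      by (simp add: act_add act_scale dot_add_left dot_add_right dot_scale_left dot_scale_right
          dot_commute[of x y] algebra_simps power2_eq_square)
  qed
  then show ?thesis by simp
qed

text \<open>
  The unit sphere inside the orthogonal complement of the \<open>u j\<close> is compact, so the quadratic form
  attains its maximum there; homogeneity extends the bound to the whole complement.
  Compactness comes from the product topology, for which vectors are made \<open>0\<close> outside \<open>V\<close>.
\<close>

lemma rayleigh_maximum_attained:
  assumes "finite J" and "card J < card V"
  obtains x \<mu> where "\<And>j. j \<in> J \<Longrightarrow> dot x (u j) = 0" and "dot x x = 1" and "dot x (act x) = \<mu>"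
    and "\<And>y. (\<And>j. j \<in> J \<Longrightarrow> dot y (u j) = 0) \<Longrightarrow> dot y (act y) \<le> \<mu> * dot y y"
proof -
  define B :: "('a \<Rightarrow> real) set" where
    "B = PiE UNIV (\<lambda>v. if v \<in> V then {-1..1} else {0})"
  define C where "C = B \<inter> {x. dot x x = 1} \<inter> (\<Inter>j\<in>J. {x. dot x (u j) = 0})"
  have coord: "continuous_on UNIV (\<lambda>x::'a \<Rightarrow> real. x v)" for v by simp
  have cont_dot: "continuous_on UNIV (\<lambda>x. dot x (w x))"
    if "\<And>v. continuous_on UNIV (\<lambda>x. w x v)" for w
    unfolding dot_def by (intro continuous_intros that coord)
  have "compactin (product_topology (\<lambda>_::'a. euclidean :: real topology) UNIV) B"
    unfolding B_def by (auto simp: compactin_PiE)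
  then have "compact B"
    by (simp only: euclidean_product_topology compactin_euclidean_iff)
  moreover have "closed {x. dot x x = 1}"
    by (intro closed_Collect_eq cont_dot coord continuous_on_const)
  moreover have "closed (\<Inter>j\<in>J. {x. dot x (u j) = 0})"
    by (intro closed_INT ballI closed_Collect_eq cont_dot continuous_on_const)
  ultimately have "compact C"
    unfolding C_def by (intro compact_Int_closed)
  have normalised: "(\<lambda>v. if v \<in> V then y v / sqrt (dot y y) else 0) \<in> C"
    if y: "\<And>j. j \<in> J \<Longrightarrow> dot y (u j) = 0" "dot y y > 0" for y
  proof -
    let ?r = "sqrt (dot y y)" and ?x = "\<lambda>v. if v \<in> V then y v / sqrt (dot y y) else 0"
    have r: "?r > 0" "?r * ?r = dot y y" using y(2) by auto
    have dot_x: "dot ?x z = dot y z / ?r" for z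
      by (simp add: dot_def sum_divide_distrib)
    have "dot ?x ?x = dot y ?x / ?r" by (rule dot_x)
    also have "\<dots> = dot ?x y / ?r" by (simp only: dot_commute)
    also have "\<dots> = 1" unfolding dot_x using r y(2) by (simp add: field_simps)
    finally have one: "dot ?x ?x = 1" .
    have "?x v \<in> {-1..1}" if "v \<in> V" for v
    proof -
      have "?x v * ?x v \<le> dot ?x ?x"
        unfolding dot_def using finite_V that by (intro member_le_sum) auto
      then have "(?x v)\<^sup>2 \<le> 1" unfolding one power2_eq_square .
      then have "\<bar>?x v\<bar> \<le> 1" by (simp only: abs_square_le_1)
      then show ?thesis unfolding abs_le_iff atLeastAtMost_iff by linarith
    qed
    then have "?x \<in> B" by (auto simp: B_def)
    with one y(1) dot_x show ?thesis by (auto simp: C_def)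
  qed
  have "C \<noteq> {}"
  proof -
    from homogeneous_system_solution[OF assms(1) finite_V assms(2), of u]
    obtain y where y: "\<exists>v\<in>V. y v \<noteq> 0" "\<forall>j\<in>J. (\<Sum>v\<in>V. u j v * y v) = 0" by blast
    then have "dot y y > 0" using dot_self_pos by blast
    moreover have "dot y (u j) = 0" if "j \<in> J" for j
      using y(2) that by (simp add: dot_def mult.commute)
    ultimately show ?thesis using normalised by blast
  qed
  have cont: "continuous_on C (\<lambda>x. dot x (act x))"
    by (rule continuous_on_subset[OF cont_dot subset_UNIV], unfold act_def)
       (intro continuous_intros coord)
  from continuous_attains_sup[OF \<open>compact C\<close> \<open>C \<noteq> {}\<close> cont] obtain x where x: "x \<in> C"
    "\<And>y. y \<in> C \<Longrightarrow> dot y (act y) \<le> dot x (act x)" by blast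
  have "dot y (act y) \<le> dot x (act x) * dot y y" if y: "\<And>j. j \<in> J \<Longrightarrow> dot y (u j) = 0" for y
  proof (cases "dot y y > 0")
    case True
    define r where "r = sqrt (dot y y)"
    have r: "r > 0" "r * r = dot y y" using True by (auto simp: r_def)
    let ?z = "\<lambda>v. if v \<in> V then y v / r else 0"
    have eq: "act ?z = act (\<lambda>v. 1 / r * y v)" by (rule act_cong) simp
    have "dot ?z (act ?z) = dot (\<lambda>v. 1 / r * y v) (act (\<lambda>v. 1 / r * y v))"
      unfolding eq by (rule dot_cong) auto
    also have "\<dots> = dot y (act y) / (r * r)"
      by (simp only: act_scale dot_scale_left dot_scale_right) simp
    finally have "dot y (act y) / (r * r) \<le> dot x (act x)"
      using x(2)[OF normalised[OF y True, folded r_def]] by simp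
    then show ?thesis using True r by (simp add: field_simps)
  next
    case False
    then have "dot y y = 0" using dot_self_nonneg[of y] by simp
    then have "\<forall>v\<in>V. y v = 0" by (simp add: dot_self_eq_0_iff)
    then have "dot y (act y) = 0" by (simp add: dot_def)
    with \<open>dot y y = 0\<close> show ?thesis by simp
  qed
  with x(1) show thesis by (intro that[of x "dot x (act x)"]) (auto simp: C_def)
qed

text \<open>
  The last clause is the Courant-Fischer characterisation of \<open>d i\<close>. Keeping it as part of the
  data makes the \<open>d i\<close> decrease and gives the bounds on the form that the graph argument needs.
\<close>

definition eigenbasis :: "nat \<Rightarrow> (nat \<Rightarrow> 'a \<Rightarrow> real) \<Rightarrow> (nat \<Rightarrow> real) \<Rightarrow> bool" where
  "eigenbasis m u d \<longleftrightarrow>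
     (\<forall>i<m. \<forall>j<m. dot (u i) (u j) = (if i = j then 1 else 0))
   \<and> (\<forall>i<m. \<forall>v\<in>V. act (u i) v = d i * u i v)
   \<and> (\<forall>i<m. \<forall>x. (\<forall>j<i. dot x (u j) = 0) \<longrightarrow> dot x (act x) \<le> d i * dot x x)"

lemma eigenbasisD:
  assumes "eigenbasis m u d" and "i < m"
  shows "j < m \<Longrightarrow> dot (u i) (u j) = (if i = j then 1 else 0)"
    and "v \<in> V \<Longrightarrow> act (u i) v = d i * u i v"
    and "(\<And>j. j < i \<Longrightarrow> dot x (u j) = 0) \<Longrightarrow> dot x (act x) \<le> d i * dot x x"
    and "dot z (act (u i)) = d i * dot z (u i)"
proof -
  show act: "act (u i) v = d i * u i v" if "v \<in> V" for v
    using assms that by (simp add: eigenbasis_def)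
  show "dot z (act (u i)) = d i * dot z (u i)"
    unfolding dot_scale_right[symmetric] by (rule dot_cong) (auto simp: act)
qed (use assms in \<open>auto simp: eigenbasis_def\<close>)

text \<open>
  The spectral theorem: the maximiser of the form on the complement of the earlier eigenvectors is an
  eigenvector, because that complement is invariant under the symmetric map.
\<close>

lemma eigenbasis_exists:
  assumes "m \<le> card V"
  shows "\<exists>u d. eigenbasis m u d"
  using assms
proof (induction m)
  case 0
  show ?case by (simp add: eigenbasis_def)
next
  case (Suc m)
  then obtain u d where ud: "eigenbasis m u d" by auto
  have "card {..<m} < card V" using Suc.prems by simp
  then obtain x \<mu> where x: "\<And>j. j < m \<Longrightarrow> dot x (u j) = 0" "dot x x = 1" "dot x (act x) = \<mu>"
    and max: "\<And>y. (\<And>j. j < m \<Longrightarrow> dot y (u j) = 0) \<Longrightarrow> dot y (act y) \<le> \<mu> * dot y y"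
    using rayleigh_maximum_attained[of "{..<m}" u] by (metis finite_lessThan lessThan_iff)
  have stationary: "dot y (act x) = \<mu> * dot y x" if y: "\<And>j. j < m \<Longrightarrow> dot y (u j) = 0" for y
  proof (rule maximiser_stationary)
    fix t
    show "dot (\<lambda>v. x v + t * y v) (act (\<lambda>v. x v + t * y v))
      \<le> \<mu> * dot (\<lambda>v. x v + t * y v) (\<lambda>v. x v + t * y v)"
      by (rule max) (simp add: dot_add_left dot_scale_left x y)
  qed (simp add: x)
  \<comment> \<open>the residual is orthogonal to the earlier vectors, hence to itself\<close>
  define y where "y = (\<lambda>v. act x v + (- \<mu>) * x v)"
  have "dot y (u j) = 0" if "j < m" for j
  proof -
    have "dot (act x) (u j) = d j * dot x (u j)"
      using eigenbasisD(4)[OF ud that] dot_act_symmetric by metis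
    then show ?thesis unfolding y_def dot_add_left dot_scale_left using x(1)[OF that] by simp
  qed
  then have "dot y (act x) = \<mu> * dot y x" by (rule stationary)
  moreover have "dot y y = dot y (act x) + (- \<mu>) * dot y x"
    by (subst (2) y_def) (simp only: dot_add_right dot_scale_right)
  ultimately have "dot y y = 0" by simp
  then have act_x: "act x v = \<mu> * x v" if "v \<in> V" for v
    using that by (simp add: dot_self_eq_0_iff y_def)
  let ?u = "u(m := x)" and ?d = "d(m := \<mu>)"
  have "dot (?u i) (?u j) = (if i = j then 1 else 0)" if "i < Suc m" "j < Suc m" for i j
    using that eigenbasisD(1)[OF ud, of i j] x(1)[of i] x(1)[of j] x(2) dot_commute[of x "u i"]
    by (cases "i = m"; cases "j = m") simp_all
  moreover have "act (?u i) v = ?d i * ?u i v" if "i < Suc m" "v \<in> V" for i v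
    using that eigenbasisD(2)[OF ud, of i v] act_x by (cases "i = m") simp_all
  moreover have "dot y (act y) \<le> ?d i * dot y y"
    if "i < Suc m" "\<forall>j<i. dot y (?u j) = 0" for i y
  proof (cases "i = m")
    case True
    then have "dot y (u j) = 0" if "j < m" for j
      using that \<open>\<forall>j<i. dot y (?u j) = 0\<close> by auto
    then show ?thesis using max True by simp
  next
    case False
    then have "i < m" using that by simp
    moreover have "dot y (u j) = 0" if "j < i" for j
      using that \<open>\<forall>j<i. dot y (?u j) = 0\<close> \<open>i < m\<close> by fastforce
    ultimately show ?thesis using eigenbasisD(3)[OF ud] False by simp
  qed
  ultimately have "eigenbasis (Suc m) ?u ?d" unfolding eigenbasis_def by blast
  then show ?case by blast
qed

lemma eigenbasis_decreasing:
  assumes "eigenbasis m u d" and "i \<le> j" and "j < m"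
  shows "d j \<le> d i"
proof (cases "i = j")
  case False
  have "dot (u j) (act (u j)) \<le> d i * dot (u j) (u j)"
    using assms False by (intro eigenbasisD(3)[OF assms(1)]) (auto simp: eigenbasisD(1)[OF assms(1)])
  then show ?thesis
    using assms by (simp add: eigenbasisD(1,4)[OF assms(1)])
qed simp

end

section \<open>The characteristic polynomial\<close>

lemma proots_prod_linear_factors: "proots (\<Prod>a\<leftarrow>as. [:- a, 1:]) = mset (as :: real list)"
proof (induction as)
  case (Cons a as)
  have "(\<Prod>a\<leftarrow>as. [:- a, 1:]) \<noteq> (0 :: real poly)" by (auto simp: prod_list_zero_iff)
  then have "proots ([:- a, 1:] * (\<Prod>a\<leftarrow>as. [:- a, 1:])) = {#a#} + mset as"
    by (subst proots_mult) (simp_all add: Cons)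
  then show ?case by simp
qed simp

context symmetric_kernel
begin

text \<open>
  The matrix \<open>P\<close> with columns \<open>u j\<close> is orthogonal and diagonalises the kernel, so
  algebraic and geometric multiplicities agree.
\<close>

lemma char_poly_eigenbasis:
  assumes basis: "eigenbasis (card V) u d" and vs: "distinct vs" "set vs = V"
  shows "char_poly (mat (length vs) (length vs) (\<lambda>(i, j). K (vs ! i) (vs ! j)))
    = (\<Prod>a\<leftarrow>map d [0..<card V]. [:- a, 1:])"
proof -
  define N where "N = card V"
  have len: "length vs = N" using vs by (metis N_def distinct_card)
  have nth: "vs ! i \<in> V" if "i < N" for i using that vs len by auto
  have sum_nth: "(\<Sum>k = 0..<N. f (vs ! k)) = sum f V" for f :: "'a \<Rightarrow> real"
    using sum.reindex_bij_betw[OF bij_betw_nth[OF vs(1), of "{0..<N}" V], of f] vs len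
    by (simp add: atLeast0LessThan)
  define A where "A = mat N N (\<lambda>(i, j). K (vs ! i) (vs ! j))"
  define P where "P = mat N N (\<lambda>(i, j). u j (vs ! i))"
  define Q where "Q = mat N N (\<lambda>(i, j). u i (vs ! j))"
  define D where "D = mat N N (\<lambda>(i, j). if i = j then d i else 0)"
  have carrier: "A \<in> carrier_mat N N" "P \<in> carrier_mat N N" "Q \<in> carrier_mat N N"
    "D \<in> carrier_mat N N" by (auto simp: A_def P_def Q_def D_def)
  have QP: "Q * P = 1\<^sub>m N"
  proof (rule eq_matI)
    fix i j assume "i < dim_row (1\<^sub>m N)" "j < dim_col (1\<^sub>m N)"
    then have ij: "i < N" "j < N" by auto
    then have "(Q * P) $$ (i, j) = (\<Sum>k = 0..<N. u i (vs ! k) * u j (vs ! k))"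
      by (simp add: P_def Q_def scalar_prod_def)
    also have "\<dots> = dot (u i) (u j)" unfolding dot_def by (rule sum_nth)
    finally show "(Q * P) $$ (i, j) = 1\<^sub>m N $$ (i, j)"
      using ij eigenbasisD(1)[OF basis] by (simp add: N_def)
  qed (auto simp: P_def Q_def)
  have PQ: "P * Q = 1\<^sub>m N"
    using mat_mult_left_right_inverse[OF carrier(3,2) QP] .
  have AP: "A * P = P * D"
  proof (rule eq_matI)
    fix i j assume "i < dim_row (P * D)" "j < dim_col (P * D)"
    then have ij: "i < N" "j < N" by (auto simp: P_def D_def)
    then have "(A * P) $$ (i, j) = (\<Sum>k = 0..<N. K (vs ! i) (vs ! k) * u j (vs ! k))"
      by (simp add: A_def P_def scalar_prod_def)
    also have "\<dots> = act (u j) (vs ! i)" unfolding act_def by (rule sum_nth)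
    also have "\<dots> = u j (vs ! i) * d j"
      using ij nth eigenbasisD(2)[OF basis] by (simp add: N_def)
    also have "\<dots> = (\<Sum>k = 0..<N. u k (vs ! i) * (if k = j then d k else 0))"
      using ij by (simp add: if_distrib[of "\<lambda>x. _ * x"] cong: if_cong)
    also have "\<dots> = (P * D) $$ (i, j)" using ij by (simp add: P_def D_def scalar_prod_def)
    finally show "(A * P) $$ (i, j) = (P * D) $$ (i, j)" .
  qed (auto simp: A_def P_def D_def)
  have "A = A * (P * Q)" using PQ carrier by simp
  also have "\<dots> = P * D * Q" using AP carrier by (metis assoc_mult_mat)
  finally have "similar_mat A D"
    using PQ QP carrier by (intro similar_matI[of _ _ P Q N]) auto
  then have "char_poly A = char_poly D" by (rule char_poly_similar)
  also have "\<dots> = (\<Prod>a\<leftarrow>diag_mat D. [:- a, 1:])"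
    by (rule char_poly_upper_triangular[OF carrier(4)]) (auto simp: D_def upper_triangular_def)
  also have "diag_mat D = map d [0..<N]" by (auto simp: diag_mat_def D_def)
  finally show ?thesis unfolding A_def len N_def .
qed

section \<open>The quadratic form on parts of the index set\<close>

text \<open>
  If the form exceeded \<open>d 1\<close> on both \<open>x\<close> and \<open>y\<close>, it would do so on the whole plane they
  span. But this plane contains a nonzero vector orthogonal to \<open>u 0\<close>, on which the form is at most
  \<open>d 1\<close>.
\<close>

lemma orthogonal_form_bound:
  assumes basis: "eigenbasis m u d" and "1 < m"
    and xy: "dot x y = 0" "dot x (act y) = 0"
    and x: "dot x (act x) > d 1 * dot x x"
  shows "dot y (act y) \<le> d 1 * dot y y"
proof (rule ccontr)
  assume "\<not> ?thesis"
  then have y: "dot y (act y) > d 1 * dot y y" by simp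
  have yx: "dot y x = 0" "dot y (act x) = 0"
    using xy dot_commute dot_act_symmetric by metis+
  define a where "a = dot x (u 0)"
  define b where "b = dot y (u 0)"
  have bound: "dot z (act z) \<le> d 1 * dot z z" if "dot z (u 0) = 0" for z
    using that \<open>1 < m\<close> by (intro eigenbasisD(3)[OF basis]) auto
  show False
  proof (cases "a = 0")
    case True
    then show False using bound[of x] x by (simp add: a_def)
  next
    case False
    define z where "z = (\<lambda>v. b * x v + (- a) * y v)"
    have "dot z (u 0) = 0"
      unfolding z_def dot_add_left dot_scale_left by (simp add: a_def b_def)
    moreover have "dot z (act z) = b\<^sup>2 * dot x (act x) + a\<^sup>2 * dot y (act y)"
      unfolding z_def act_add act_scale dot_add_left dot_add_right dot_scale_left dot_scale_right
      by (simp add: xy yx power2_eq_square)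
    moreover have "dot z z = b\<^sup>2 * dot x x + a\<^sup>2 * dot y y"
      unfolding z_def dot_add_left dot_add_right dot_scale_left dot_scale_right
      by (simp add: xy yx power2_eq_square)
    moreover have "a\<^sup>2 * dot y (act y) > a\<^sup>2 * (d 1 * dot y y)"
      using y False by (intro mult_strict_left_mono) auto
    moreover have "b\<^sup>2 * dot x (act x) \<ge> b\<^sup>2 * (d 1 * dot x x)"
      using x by (intro mult_left_mono) auto
    ultimately show False using bound[of z] by (simp add: algebra_simps)
  qed
qed

text \<open>
  For a set \<open>U\<close> of vertices of a graph, this says that the largest eigenvalue of the induced
  subgraph on \<open>U\<close> is at most \<open>\<mu>\<close>, without a second matrix; it also makes sense for the empty set.
\<close>

definition form_le :: "real \<Rightarrow> 'a set \<Rightarrow> bool" where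
  "form_le \<mu> U \<longleftrightarrow> (\<forall>x. (\<forall>v\<in>V - U. x v = 0) \<longrightarrow> dot x (act x) \<le> \<mu> * dot x x)"

lemma form_leD:
  assumes "form_le \<mu> U" and "\<And>v. v \<in> V \<Longrightarrow> v \<notin> U \<Longrightarrow> x v = 0"
  shows "dot x (act x) \<le> \<mu> * dot x x"
  using assms unfolding form_le_def by blast

definition separated :: "'a set \<Rightarrow> 'a set \<Rightarrow> bool" where
  "separated U W \<longleftrightarrow> U \<inter> W = {} \<and> (\<forall>v\<in>U. \<forall>w\<in>W. K v w = 0)"

lemma separated_orthogonal:
  assumes "separated U W" and "\<forall>v\<in>V - U. x v = 0" and "\<forall>v\<in>V - W. y v = 0"
  shows "dot x y = 0" and "dot x (act y) = 0"
proof -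
  have "x v * y v = 0" if "v \<in> V" for v
    using assms that by (auto simp: separated_def)
  then show "dot x y = 0" unfolding dot_def by (intro sum.neutral ballI)
  have "x v * act y v = 0" if "v \<in> V" for v
  proof (cases "v \<in> U")
    case True
    then have "K v w * y w = 0" if "w \<in> V" for w
      using assms that by (auto simp: separated_def)
    then have "act y v = 0" unfolding act_def by (intro sum.neutral ballI)
    then show ?thesis by simp
  qed (use assms that in auto)
  then show "dot x (act y) = 0" unfolding dot_def by (intro sum.neutral ballI)
qed

text \<open>
  Two separated parts of a graph cannot both have largest eigenvalue above the second eigenvalue of
  the whole graph: restricted to test vectors on the two parts, the preceding lemma applies.
\<close>

lemma form_le_separated_cases:
  assumes "eigenbasis m u d" and "1 < m" and "separated U W"
  shows "form_le (d 1) U \<or> form_le (d 1) W"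
proof (rule ccontr)
  assume "\<not> ?thesis"
  then obtain x y where "\<forall>v\<in>V - U. x v = 0" "\<not> dot x (act x) \<le> d 1 * dot x x"
    "\<forall>v\<in>V - W. y v = 0" "\<not> dot y (act y) \<le> d 1 * dot y y"
    unfolding form_le_def by blast
  with separated_orthogonal[OF assms(3), of x y] orthogonal_form_bound[OF assms(1,2), of x y]
  show False by force
qed

lemma form_le_union:
  assumes sep: "separated U W" and U: "form_le \<mu> U" and W: "form_le \<mu> W"
  shows "form_le \<mu> (U \<union> W)"
  unfolding form_le_def
proof (intro allI impI)
  fix x :: "'a \<Rightarrow> real"
  assume x: "\<forall>v\<in>V - (U \<union> W). x v = 0"
  define y where "y = (\<lambda>v. if v \<in> U then x v else 0)"
  define z where "z = (\<lambda>v. if v \<in> U then 0 else x v)"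
  have x_eq: "x = (\<lambda>v. y v + z v)" by (auto simp: y_def z_def)
  have y: "\<forall>v\<in>V - U. y v = 0" and z: "\<forall>v\<in>V - W. z v = 0"
    using x by (auto simp: y_def z_def)
  note orth = separated_orthogonal[OF sep y z]
  have orth': "dot z y = 0" "dot z (act y) = 0"
    using orth dot_commute dot_act_symmetric by metis+
  have "dot y (act y) \<le> \<mu> * dot y y" "dot z (act z) \<le> \<mu> * dot z z"
    using U W y z by (auto simp: form_le_def)
  then show "dot x (act x) \<le> \<mu> * dot x x"
    unfolding x_eq act_add dot_add_left dot_add_right
    by (simp add: orth orth' algebra_simps)
qed

lemma act_abs_form_ge:
  assumes nonneg: "\<And>v w. K v w \<ge> 0"
  shows "dot x (act x) \<le> dot (\<lambda>v. \<bar>x v\<bar>) (act (\<lambda>v. \<bar>x v\<bar>))"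
  unfolding dot_def act_def sum_distrib_left
proof (intro sum_mono)
  fix v w
  have "x v * (K v w * x w) \<le> \<bar>x v * (K v w * x w)\<bar>" by simp
  also have "\<dots> = \<bar>x v\<bar> * (K v w * \<bar>x w\<bar>)" using nonneg[of v w] by (simp add: abs_mult)
  finally show "x v * (K v w * x w) \<le> \<bar>x v\<bar> * (K v w * \<bar>x w\<bar>)" .
qed

text \<open>
  The unit vector of a vertex of \<open>U\<close> is an admissible direction of variation.
\<close>

lemma maximiser_on_support:
  assumes le: "form_le \<mu> U" and x: "\<forall>v\<in>V - U. x v = 0"
    and attained: "dot x (act x) = \<mu> * dot x x" and v: "v \<in> V \<inter> U"
  shows "act x v = \<mu> * x v"
proof -
  let ?e = "\<lambda>w. if w = v then 1 else 0 :: real"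
  have "dot ?e z = z v" for z
    using v finite_V by (simp add: dot_def if_distrib[of "\<lambda>x. x * _"] cong: if_cong)
  moreover have "dot ?e (act x) = \<mu> * dot ?e x"
  proof (rule maximiser_stationary[OF _ attained])
    fix t
    show "dot (\<lambda>v. x v + t * ?e v) (act (\<lambda>v. x v + t * ?e v))
      \<le> \<mu> * dot (\<lambda>v. x v + t * ?e v) (\<lambda>v. x v + t * ?e v)"
      by (rule form_leD[OF le]) (use x v in auto)
  qed
  ultimately show ?thesis by simp
qed

text \<open>
  If the eigenspace of \<open>\<mu>\<close> had dimension above \<open>card Y\<close>, some eigenvector \<open>z \<noteq> 0\<close>
  would vanish on \<open>Y\<close>. Then \<open>\<bar>z\<bar>\<close> is supported on \<open>V - S\<close> and maximises the form there, so
  it satisfies the eigenvalue equation at every vertex outside \<open>S\<close>. Where \<open>\<bar>z\<bar>\<close> is \<open>0\<close>, that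
  equation makes the nonnegative sum over the neighbours vanish, so zeros spread to neighbours;
  at vertices of \<open>S\<close> they spread because \<open>Y\<close> contains the neighbours. By connectedness \<open>z = 0\<close>.
  Vanishing on the neighbours of \<open>S\<close> replaces a count of the components of \<open>V - S\<close>.
\<close>

lemma multiplicity_le_card:
  assumes nonneg: "\<And>v w. K v w \<ge> 0"
    and basis: "eigenbasis m u d"
    and connected: "\<And>Z. Z \<subseteq> V \<Longrightarrow> Z \<noteq> {} \<Longrightarrow> (\<And>v w. v \<in> Z \<Longrightarrow> w \<in> V \<Longrightarrow> K v w \<noteq> 0 \<Longrightarrow> w \<in> Z) \<Longrightarrow> Z = V"
    and le: "form_le \<mu> (V - S)"
    and Y: "Y \<subseteq> V" "Y \<noteq> {}" "S \<subseteq> Y" "\<And>v w. v \<in> S \<Longrightarrow> w \<in> V \<Longrightarrow> K v w \<noteq> 0 \<Longrightarrow> w \<in> Y"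
  shows "card {k. k < m \<and> d k = \<mu>} \<le> card Y"
proof (rule ccontr)
  define I where "I = {k. k < m \<and> d k = \<mu>}"
  assume "\<not> card {k. k < m \<and> d k = \<mu>} \<le> card Y"
  then have "card Y < card I" by (simp add: I_def)
  moreover have finI: "finite I" and "finite Y"
    using Y finite_V by (auto simp: I_def intro: finite_subset)
  ultimately obtain c where c: "\<exists>i\<in>I. c i \<noteq> 0" "\<forall>v\<in>Y. (\<Sum>i\<in>I. u i v * c i) = 0"
    using homogeneous_system_solution[of Y I "\<lambda>v i. u i v"] by blast
  define z where "z = (\<lambda>v. \<Sum>i\<in>I. c i * u i v)"
  have z_Y: "z v = 0" if "v \<in> Y" for v
    using c(2) that by (simp add: z_def mult.commute)
  have act_z: "act z v = \<mu> * z v" if "v \<in> V" for v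
    unfolding z_def act_sum act_scale sum_distrib_left
    using eigenbasisD(2)[OF basis _ that] by (intro sum.cong) (auto simp: I_def)
  have z_nz: "\<exists>v\<in>V. z v \<noteq> 0"
  proof -
    obtain i where i: "i \<in> I" "c i \<noteq> 0" using c(1) by blast
    have "dot z (u i) = (\<Sum>j\<in>I. c j * dot (u j) (u i))"
      unfolding z_def dot_sum_left dot_scale_left ..
    also have "\<dots> = (\<Sum>j\<in>I. if j = i then c i else 0)"
      using i by (intro sum.cong) (auto simp: I_def eigenbasisD(1)[OF basis])
    also have "\<dots> = c i" using i(1) finI by simp
    finally have "dot z (u i) \<noteq> 0" using i(2) by simp
    then obtain v where "v \<in> V" "z v * u i v \<noteq> 0"
      unfolding dot_def by (rule sum.not_neutral_contains_not_neutral)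
    then show ?thesis by auto
  qed
  define x where "x = (\<lambda>v. \<bar>z v\<bar>)"
  have x_S: "\<forall>v\<in>V - (V - S). x v = 0" using Y(3) z_Y by (auto simp: x_def)
  have norm: "dot x x = dot z z" by (simp add: dot_def x_def)
  have "dot z (act z) = \<mu> * dot z z"
    unfolding dot_scale_right[symmetric] by (rule dot_cong) (auto simp: act_z)
  moreover have "dot z (act z) \<le> dot x (act x)"
    unfolding x_def by (rule act_abs_form_ge[OF nonneg])
  moreover have "dot x (act x) \<le> \<mu> * dot x x" using le x_S by (auto simp: form_le_def)
  ultimately have attained: "dot x (act x) = \<mu> * dot x x" using norm by simp
  have "{v \<in> V. x v = 0} = V"
  proof (rule connected)
    show "{v \<in> V. x v = 0} \<noteq> {}" using Y(1,2) z_Y by (auto simp: x_def)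
    fix v w assume v: "v \<in> {v \<in> V. x v = 0}" and w: "w \<in> V" "K v w \<noteq> 0"
    have "x w = 0"
    proof (cases "v \<in> S")
      case True
      then show ?thesis using Y(4) w z_Y by (auto simp: x_def)
    next
      case False
      then have "act x v = \<mu> * x v"
        using v by (intro maximiser_on_support[OF le x_S attained]) auto
      then have "(\<Sum>w\<in>V. K v w * x w) = 0" using v by (simp add: act_def)
      then have "\<forall>w\<in>V. K v w * x w = 0"
        using finite_V nonneg by (subst (asm) sum_nonneg_eq_0_iff) (auto simp: x_def)
      then show ?thesis using w by auto
    qed
    then show "w \<in> {v \<in> V. x v = 0}" using w by simp
  qed auto
  then show False using z_nz by (auto simp: x_def)
qed

end

section \<open>The adjacency matrix of a graph\<close>

abbreviation adjacency :: "'a pair_pre_digraph \<Rightarrow> 'a \<Rightarrow> 'a \<Rightarrow> real" where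
  "adjacency G v w \<equiv> of_bool ((v, w) \<in> parcs G)"

lemma adjacency_symmetric_kernel:
  assumes "pair_graph G"
  shows "symmetric_kernel (pverts G) (adjacency G)"
proof -
  interpret pair_graph G by fact
  show ?thesis by unfold_locales (auto intro: arcs_symmetric pair_finite_verts)
qed

context
  fixes G :: "'a pair_pre_digraph" and u :: "nat \<Rightarrow> 'a \<Rightarrow> real" and d :: "nat \<Rightarrow> real"
  assumes G: "pair_graph G"
    and basis: "symmetric_kernel.eigenbasis (pverts G) (adjacency G) (card (pverts G)) u d"
begin

interpretation symmetric_kernel "pverts G" "adjacency G"
  by (rule adjacency_symmetric_kernel[OF G])

lemma char_poly_adjacency_matrix:
  "char_poly (adjacency_matrix G) = (\<Prod>a\<leftarrow>map d [0..<card (pverts G)]. [:- a, 1:])"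
proof -
  have "distinct (vertex_list G) \<and> set (vertex_list G) = pverts G"
    unfolding vertex_list_def
    by (rule someI_ex) (use finite_distinct_list[OF finite_V] in blast)
  moreover have "adjacency_matrix G = mat (length (vertex_list G)) (length (vertex_list G))
      (\<lambda>(i, j). adjacency G (vertex_list G ! i) (vertex_list G ! j))"
    by (simp add: adjacency_matrix_def of_bool_def Let_def)
  ultimately show ?thesis using char_poly_eigenbasis[OF basis] by simp
qed

lemma graph_eigenvalue_eigenbasis:
  assumes "0 < k" and "k \<le> card (pverts G)"
  shows "graph_eigenvalue G k = d (k - 1)"
proof -
  let ?ds = "map d [0..<card (pverts G)]"
  have "sorted_wrt (\<ge>) ?ds"
    using eigenbasis_decreasing[OF basis] by (auto simp: sorted_wrt_iff_nth_less)
  then have "sorted (rev ?ds)" by (simp add: sorted_wrt_rev)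
  then have "sort ?ds = rev ?ds" by (intro properties_for_sort) auto
  then have "graph_eigenvalues G = ?ds"
    by (simp add: graph_eigenvalues_def char_poly_adjacency_matrix proots_prod_linear_factors
        del: map_map mset_map)
  then show ?thesis using assms by (simp add: graph_eigenvalue_def)
qed

lemma eigenvalue_multiplicity_eigenbasis:
  "eigenvalue_multiplicity G x = card {k. k < card (pverts G) \<and> d k = x}"
proof -
  let ?ds = "map d [0..<card (pverts G)]" and ?p = "char_poly (adjacency_matrix G)"
  have "?p \<noteq> 0" unfolding char_poly_adjacency_matrix by (auto simp: prod_list_zero_iff)
  then have "eigenvalue_multiplicity G x = count (proots ?p) x"
    by (simp add: eigenvalue_multiplicity_def)
  also have "\<dots> = count (mset ?ds) x"
    unfolding char_poly_adjacency_matrix proots_prod_linear_factors ..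
  also have "\<dots> = card {k. k < length ?ds \<and> x = ?ds ! k}"
    unfolding count_mset count_list_eq_length_filter length_filter_conv_card ..
  also have "{k. k < length ?ds \<and> x = ?ds ! k} = {k. k < card (pverts G) \<and> d k = x}" by auto
  finally show ?thesis .
qed

end

section \<open>Spiders with three legs\<close>

text \<open>
  The image need not be an induced subgraph: further arcs only increase the quadratic form on
  nonnegative vectors.
\<close>

definition embeds :: "('a \<Rightarrow> 'b) \<Rightarrow> 'a pair_pre_digraph \<Rightarrow> 'b pair_pre_digraph \<Rightarrow> bool" where
  "embeds f H G \<longleftrightarrow> inj_on f (pverts H) \<and> f ` pverts H \<subseteq> pverts G
     \<and> (\<forall>v w. (v, w) \<in> parcs H \<longrightarrow> (f v, f w) \<in> parcs G)"

text \<open>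
  Written as a sum over arcs, the form can be compared along maps between graphs.
\<close>

lemma form_eq_sum_arcs:
  assumes "pair_graph G"
  shows "symmetric_kernel.dot (pverts G) x (symmetric_kernel.act (pverts G) (adjacency G) x)
    = (\<Sum>(v, w)\<in>parcs G. x v * x w)"
proof -
  interpret pair_graph G by fact
  interpret symmetric_kernel "pverts G" "adjacency G"
    by (rule adjacency_symmetric_kernel[OF assms])
  have "dot x (act x) = (\<Sum>(v, w)\<in>pverts G \<times> pverts G. of_bool ((v, w) \<in> parcs G) * (x v * x w))"
    unfolding dot_def act_def sum_distrib_left sum.cartesian_product
    by (intro sum.cong) auto
  also have "\<dots> = (\<Sum>(v, w)\<in>parcs G. x v * x w)"
    using finite_V by (intro sum.mono_neutral_cong_right) (auto dest: in_arcsD1 in_arcsD2)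
  finally show ?thesis .
qed

text \<open>
  The absolute value of a leading eigenvector of \<open>H\<close>, transported along \<open>f\<close> and extended by
  \<open>0\<close>, is a test vector in \<open>G\<close>.
\<close>

lemma embedding_not_form_le:
  fixes H :: "'b pair_pre_digraph" and G :: "'a pair_pre_digraph"
  assumes H: "pair_graph H" and G: "pair_graph G" and "pverts H \<noteq> {}" and f: "embeds f H G"
    and \<mu>: "\<mu> < graph_eigenvalue H 1"
  shows "\<not> symmetric_kernel.form_le (pverts G) (adjacency G) \<mu> (f ` pverts H)"
proof
  interpret H: symmetric_kernel "pverts H" "adjacency H"
    by (rule adjacency_symmetric_kernel[OF H])
  interpret G: symmetric_kernel "pverts G" "adjacency G"
    by (rule adjacency_symmetric_kernel[OF G])
  interpret HG: pair_graph H by fact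
  interpret GG: pair_graph G by fact
  assume le: "G.form_le \<mu> (f ` pverts H)"
  have inj: "inj_on f (pverts H)" and sub: "f ` pverts H \<subseteq> pverts G"
    and arc: "\<And>v w. (v, w) \<in> parcs H \<Longrightarrow> (f v, f w) \<in> parcs G"
    using f by (auto simp: embeds_def)
  have N: "0 < card (pverts H)" using assms(3) H.finite_V by (simp add: card_gt_0_iff)
  obtain u d where basis: "H.eigenbasis (card (pverts H)) u d"
    using H.eigenbasis_exists by blast
  define x where "x = (\<lambda>v. \<bar>u 0 v\<bar>)"
  define y where "y = (\<lambda>w. if w \<in> f ` pverts H then x (the_inv_into (pverts H) f w) else 0)"
  have y_f: "y (f v) = x v" if "v \<in> pverts H" for v
    using that by (simp add: y_def the_inv_into_f_f[OF inj])
  have y_nonneg: "y w \<ge> 0" for w by (simp add: y_def x_def)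
  have "H.dot (u 0) (u 0) = 1" using H.eigenbasisD(1)[OF basis N N] by simp
  then have norm_x: "H.dot x x = 1" by (simp add: H.dot_def x_def)
  have "G.dot y y = (\<Sum>w\<in>f ` pverts H. y w * y w)"
    unfolding G.dot_def using sub G.finite_V by (intro sum.mono_neutral_right) (auto simp: y_def)
  also have "\<dots> = H.dot x x"
    unfolding H.dot_def sum.reindex[OF inj] by (intro sum.cong) (auto simp: y_f)
  finally have norm_y: "G.dot y y = 1" using norm_x by simp
  have "graph_eigenvalue H 1 = d 0"
    using graph_eigenvalue_eigenbasis[OF H basis, of 1] N by simp
  also have "\<dots> = H.dot (u 0) (H.act (u 0))"
    using H.eigenbasisD(1,4)[OF basis N] N by simp
  also have "\<dots> \<le> H.dot x (H.act x)"
    unfolding x_def by (rule H.act_abs_form_ge) simp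
  also have "\<dots> = (\<Sum>(v, w)\<in>parcs H. y (f v) * y (f w))"
  proof -
    have "y (f v) = x v \<and> y (f w) = x w" if "(v, w) \<in> parcs H" for v w
      using y_f[OF HG.in_arcsD1[OF that]] y_f[OF HG.in_arcsD2[OF that]] ..
    then show ?thesis unfolding form_eq_sum_arcs[OF H] by (intro sum.cong) auto
  qed
  also have "\<dots> = (\<Sum>(v, w)\<in>map_prod f f ` parcs H. y v * y w)"
  proof (subst sum.reindex)
    show "inj_on (map_prod f f) (parcs H)"
      using HG.in_arcsD1 HG.in_arcsD2 by (intro inj_on_subset[OF map_prod_inj_on[OF inj inj]]) auto
  qed (auto intro!: sum.cong)
  also have "\<dots> \<le> (\<Sum>(v, w)\<in>parcs G. y v * y w)"
    using arc GG.pair_finite_arcs y_nonneg by (intro sum_mono2) auto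
  also have "\<dots> = G.dot y (G.act y)" by (rule form_eq_sum_arcs[OF G, symmetric])
  also have "\<dots> \<le> \<mu> * G.dot y y" by (rule G.form_leD[OF le]) (simp add: y_def)
  finally show False using \<mu> norm_y by simp
qed

lemma pverts_three_paths:
  "pverts (three_paths n n n) = insert (0, 0) ((\<lambda>(i, j). (i, Suc j)) ` ({..<3} \<times> {..<n}))"
proof -
  have len: "[n, n, n] ! i = n" if "i < 3" for i using that by (auto simp: less_Suc_eq numeral_3_eq_3)
  have "pverts (three_paths n n n) = {path_vertex i j | i j. i < 3 \<and> j \<le> n}"
    by (simp add: three_paths_def Let_def len cong: conj_cong)
  also have "\<dots> = insert (0, 0) ((\<lambda>(i, j). (i, Suc j)) ` ({..<3} \<times> {..<n}))" (is "?L = ?R")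
  proof (intro equalityI subsetI)
    fix v assume "v \<in> ?L"
    then obtain i j where v: "v = path_vertex i j" "i < 3" "j \<le> n" by blast
    show "v \<in> ?R"
    proof (cases j)
      case (Suc k)
      then show ?thesis using v by (auto simp: path_vertex_def intro!: image_eqI[of _ _ "(i, k)"])
    qed (use v in \<open>simp add: path_vertex_def\<close>)
  next
    fix v assume "v \<in> ?R"
    then consider "v = (0, 0)" | i j where "v = (i, Suc j)" "i < 3" "j < n" by auto
    then show "v \<in> ?L"
    proof cases
      case 1
      then have "v = path_vertex 0 0 \<and> (0::nat) < 3 \<and> 0 \<le> n" by (simp add: path_vertex_def)
      then show ?thesis by blast
    next
      case 2
      then have "v = path_vertex i (Suc j) \<and> i < 3 \<and> Suc j \<le> n" by (simp add: path_vertex_def)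
      then show ?thesis by blast
    qed
  qed
  finally show ?thesis .
qed

lemma parcs_three_paths:
  "parcs (three_paths n n n)
    = (\<lambda>(i, j). (path_vertex i j, path_vertex i (Suc j))) ` ({..<3} \<times> {..<n})
    \<union> (\<lambda>(i, j). (path_vertex i (Suc j), path_vertex i j)) ` ({..<3} \<times> {..<n})"
proof -
  have len: "[n, n, n] ! i = n" if "i < 3" for i using that by (auto simp: less_Suc_eq numeral_3_eq_3)
  show ?thesis by (auto simp: three_paths_def Let_def len)
qed

lemma path_vertex_in_three_paths: "i < 3 \<Longrightarrow> j \<le> n \<Longrightarrow> path_vertex i j \<in> pverts (three_paths n n n)"
  by (cases j) (auto simp: pverts_three_paths path_vertex_def intro!: image_eqI[of _ _ "(i, j - 1)"])

lemma three_paths_pair_graph: "pair_graph (three_paths n n n)"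
proof unfold_locales
  fix e assume "e \<in> parcs (three_paths n n n)"
  then show "fst e \<in> pverts (three_paths n n n)" "snd e \<in> pverts (three_paths n n n)"
    "fst e \<noteq> snd e"
    unfolding parcs_three_paths
    by (auto intro!: path_vertex_in_three_paths) (auto simp: path_vertex_def split: if_splits)
next
  show "symmetric (with_proj (three_paths n n n))"
    unfolding symmetric_def with_proj_simps parcs_three_paths by (intro symI) auto
qed (simp_all add: pverts_three_paths parcs_three_paths)

lemma card_pverts_three_paths: "card (pverts (three_paths n n n)) = 3 * n + 1"
proof -
  have "inj_on (\<lambda>(i, j). (i, Suc j)) ({..<3::nat} \<times> {..<n})" by (auto simp: inj_on_def)
  then have "card ((\<lambda>(i, j). (i, Suc j)) ` ({..<3::nat} \<times> {..<n})) = 3 * n"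
    by (simp add: card_image card_cartesian_product)
  then show ?thesis unfolding pverts_three_paths by (subst card_insert_disjoint) auto
qed

text \<open>
  The test vector takes the value \<open>(1 / sqrt 2) ^ j\<close> at distance \<open>j\<close> from the centre. On the
  spider with infinite legs it is an eigenvector for \<open>3 / sqrt 2\<close>: with \<open>r = 1 / sqrt 2\<close>, the
  equation is \<open>3 * r = \<lambda>\<close> at the centre and \<open>1 / r + r = \<lambda>\<close> on the legs. The two sides
  are the form and \<open>\<lambda>\<^sub>1\<close> times the squared norm of its truncation.
\<close>

lemma three_paths_eigenvalue_ge:
  fixes n :: nat
  defines "s \<equiv> \<Sum>j<n. (1 / 2 :: real) ^ j"
  shows "3 * sqrt 2 * s \<le> graph_eigenvalue (three_paths n n n) 1 * (1 + 3 / 2 * s)"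
proof -
  let ?T = "three_paths n n n" and ?I = "{..<3::nat} \<times> {..<n}"
  interpret symmetric_kernel "pverts ?T" "adjacency ?T"
    by (rule adjacency_symmetric_kernel[OF three_paths_pair_graph])
  obtain u d where basis: "eigenbasis (card (pverts ?T)) u d"
    using eigenbasis_exists by blast
  define r where "r = 1 / sqrt (2::real)"
  have r: "r * r = 1 / 2" "2 * r = sqrt 2" by (auto simp: r_def real_div_sqrt)
  have r_pow: "r ^ j * r ^ j = (1 / 2) ^ j" for j by (metis r(1) power_mult_distrib)
  define x where "x = (\<lambda>v :: nat \<times> nat. r ^ snd v)"
  have x_pv: "x (path_vertex i j) = r ^ j" for i j by (simp add: x_def path_vertex_def)
  have "dot x x = (\<Sum>v\<in>pverts ?T. x v * x v)" by (rule dot_def)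
  also have "\<dots> = x (0, 0) * x (0, 0) + (\<Sum>(i, j)\<in>?I. x (i, Suc j) * x (i, Suc j))"
    unfolding pverts_three_paths
    by (subst sum.insert) (auto simp: sum.reindex inj_on_def case_prod_unfold)
  also have "\<dots> = 1 + (\<Sum>(i, j)\<in>?I. 1 / 2 * (1 / 2) ^ j)"
  proof -
    have "x (i, Suc j) * x (i, Suc j) = 1 / 2 * (1 / 2) ^ j" for i j
      unfolding x_def snd_conv r_pow by simp
    moreover have "x (0, 0) = 1" by (simp add: x_def)
    ultimately show ?thesis by (simp only: mult_1)
  qed
  also have "\<dots> = 1 + 3 / 2 * s"
    unfolding sum.cartesian_product[symmetric] s_def by (simp add: sum_divide_distrib[symmetric])
  finally have norm: "dot x x = 1 + 3 / 2 * s" .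
  let ?f = "\<lambda>(i, j). (path_vertex i j, path_vertex i (Suc j))"
  let ?g = "\<lambda>(i, j). (path_vertex i (Suc j), path_vertex i j)"
  have inj: "inj_on ?f ?I" "inj_on ?g ?I"
    by (auto simp: inj_on_def path_vertex_def split: if_splits)
  have disj: "?f ` ?I \<inter> ?g ` ?I = {}" by (auto simp: path_vertex_def split: if_splits)
  have "dot x (act x) = (\<Sum>(v, w)\<in>parcs ?T. x v * x w)"
    by (rule form_eq_sum_arcs[OF three_paths_pair_graph])
  also have "\<dots> = (\<Sum>(v, w)\<in>?f ` ?I. x v * x w) + (\<Sum>(v, w)\<in>?g ` ?I. x v * x w)"
    unfolding parcs_three_paths using disj by (intro sum.union_disjoint) auto
  also have "\<dots> = 2 * (\<Sum>(i, j)\<in>?I. r * (1 / 2) ^ j)"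
    unfolding sum.reindex[OF inj(1)] sum.reindex[OF inj(2)]
    by (simp add: case_prod_unfold x_pv r_pow[symmetric] mult_ac)
  also have "\<dots> = 3 * (2 * r) * s"
    unfolding sum.cartesian_product[symmetric] s_def by (simp add: sum_distrib_left[symmetric])
  finally have form: "dot x (act x) = 3 * sqrt 2 * s" using r by simp
  have N: "0 < card (pverts ?T)" by (simp add: card_pverts_three_paths)
  have "graph_eigenvalue ?T 1 = d 0"
    using graph_eigenvalue_eigenbasis[OF three_paths_pair_graph basis, of 1] N by simp
  then show ?thesis using eigenbasisD(3)[OF basis N, of x] form norm by simp
qed

text \<open>
  As the legs grow, \<open>s\<close> tends to \<open>2\<close> in the preceding bound, whose Rayleigh quotient thus tends
  to \<open>3 / sqrt 2\<close>. Hence the minimum that defines \<open>n_lambda\<close> is taken over a nonempty set.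
\<close>

lemma three_paths_eigenvalue_exceeds:
  assumes "lam < 3 / sqrt 2"
  shows "\<exists>n>0. graph_eigenvalue (three_paths n n n) 1 > lam"
proof -
  define s where "s = (\<lambda>n. \<Sum>j<n. (1 / 2 :: real) ^ j)"
  have "s \<longlonglongrightarrow> 2"
    using geometric_sums[of "1 / 2 :: real"] by (simp add: s_def sums_def)
  then have "(\<lambda>n. 3 * sqrt 2 * s n - lam * (1 + 3 / 2 * s n))
      \<longlonglongrightarrow> 3 * sqrt 2 * 2 - lam * (1 + 3 / 2 * 2)"
    by (intro tendsto_intros)
  moreover have "3 * sqrt 2 * 2 - lam * (1 + 3 / 2 * 2) > 0"
  proof -
    have "3 / sqrt 2 = 3 * sqrt 2 / 2" by (simp add: field_simps)
    then show ?thesis using assms by simp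
  qed
  ultimately have "\<forall>\<^sub>F n in sequentially. 0 < 3 * sqrt 2 * s n - lam * (1 + 3 / 2 * s n)"
    by (rule order_tendstoD)
  then obtain m where m: "\<And>n. n \<ge> m \<Longrightarrow> 0 < 3 * sqrt 2 * s n - lam * (1 + 3 / 2 * s n)"
    unfolding eventually_sequentially by blast
  define n where "n = Suc m"
  have "lam * (1 + 3 / 2 * s n) < 3 * sqrt 2 * s n" using m[of n] by (simp add: n_def)
  also have "\<dots> \<le> graph_eigenvalue (three_paths n n n) 1 * (1 + 3 / 2 * s n)"
    unfolding s_def by (rule three_paths_eigenvalue_ge)
  finally have "lam * (1 + 3 / 2 * s n) < graph_eigenvalue (three_paths n n n) 1 * (1 + 3 / 2 * s n)" .
  moreover have "1 + 3 / 2 * s n > 0" by (simp add: s_def sum_nonneg add_pos_nonneg)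
  ultimately have "lam < graph_eigenvalue (three_paths n n n) 1" by simp
  then show ?thesis by (auto simp: n_def)
qed

lemma n_lambda:
  assumes "lam < 3 / sqrt 2"
  shows "0 < n_lambda lam"
    and "lam < graph_eigenvalue (three_paths (n_lambda lam) (n_lambda lam) (n_lambda lam)) 1"
  using LeastI_ex[OF three_paths_eigenvalue_exceeds[OF assms]] by (simp_all add: n_lambda_def)

text \<open>
  The three initial vertices of the legs are one vertex of the spider, so a copy of the spider is the
  same as three walks \<open>\<beta> 0\<close>, \<open>\<beta> 1\<close>, \<open>\<beta> 2\<close> from \<open>c\<close> without any other repetition.
\<close>

lemma three_paths_embedding:
  fixes \<beta> :: "nat \<Rightarrow> nat \<Rightarrow> 'a"
  assumes "0 < n"
    and start: "\<And>i. i < 3 \<Longrightarrow> \<beta> i 0 = c"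
    and arc: "\<And>i j. i < 3 \<Longrightarrow> j < n \<Longrightarrow> (\<beta> i j, \<beta> i (Suc j)) \<in> parcs G"
    and avoids: "\<And>i j. i < 3 \<Longrightarrow> 0 < j \<Longrightarrow> j \<le> n \<Longrightarrow> \<beta> i j \<noteq> c"
    and inj: "\<And>i j i' j'. i < 3 \<Longrightarrow> i' < 3 \<Longrightarrow> 0 < j \<Longrightarrow> 0 < j' \<Longrightarrow> j \<le> n \<Longrightarrow> j' \<le> n
      \<Longrightarrow> \<beta> i j = \<beta> i' j' \<Longrightarrow> i = i' \<and> j = j'"
    and G: "pair_graph G"
  shows "embeds (\<lambda>(i, j). \<beta> i j) (three_paths n n n) G"
proof -
  interpret pair_graph G by fact
  let ?f = "\<lambda>(i, j). \<beta> i j"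
  have f_pv: "?f (path_vertex i j) = \<beta> i j" if "i < 3" for i j
    using start[of 0] start[OF that] by (simp add: path_vertex_def)
  have arcs: "(?f v, ?f w) \<in> parcs G" if "(v, w) \<in> parcs (three_paths n n n)" for v w
  proof -
    from that consider i j where "i < 3" "j < n" "v = path_vertex i j" "w = path_vertex i (Suc j)"
      | i j where "i < 3" "j < n" "v = path_vertex i (Suc j)" "w = path_vertex i j"
      unfolding parcs_three_paths by auto
    then show ?thesis
      by cases (simp_all only: f_pv arc arcs_symmetric[OF arc])
  qed
  have "inj_on ?f (pverts (three_paths n n n))"
    unfolding pverts_three_paths
  proof (intro inj_onI)
    fix v w
    assume v: "v \<in> insert (0, 0) ((\<lambda>(i, j). (i, Suc j)) ` ({..<3} \<times> {..<n}))"
      and w: "w \<in> insert (0, 0) ((\<lambda>(i, j). (i, Suc j)) ` ({..<3} \<times> {..<n}))"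
      and eq: "?f v = ?f w"
    have c: "\<beta> 0 0 = c" by (simp add: start)
    from v consider "v = (0, 0)" | i j where "v = (i, Suc j)" "i < 3" "Suc j \<le> n" by auto
    note v_cases = this
    from w consider "w = (0, 0)" | i j where "w = (i, Suc j)" "i < 3" "Suc j \<le> n" by auto
    note w_cases = this
    show "v = w"
      using v_cases
    proof cases
      case 1
      from w_cases show ?thesis
      proof cases
        case (2 i j)
        then show ?thesis using 1 eq c avoids[of i "Suc j"] by simp
      qed (use 1 in simp)
    next
      case v': (2 i j)
      from w_cases show ?thesis
      proof cases
        case 1
        then show ?thesis using v' eq c avoids[of i "Suc j"] by simp
      next
        case (2 i' j')
        then show ?thesis using v' eq inj[of i i' "Suc j" "Suc j'"] by simp
      qed
    qed
  qed
  moreover have "?f v \<in> pverts G" if "v \<in> pverts (three_paths n n n)" for v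
  proof -
    have c: "c \<in> pverts G" using in_arcsD1[OF arc[of 0 0]] \<open>0 < n\<close> start[of 0] by simp
    from that consider "v = (0, 0)" | i j where "v = (i, Suc j)" "i < 3" "j < n"
      unfolding pverts_three_paths by auto
    then show ?thesis
    proof cases
      case 1
      then show ?thesis using c start[of 0] by simp
    next
      case (2 i j)
      then show ?thesis using in_arcsD2[OF arc[of i j]] by simp
    qed
  qed
  ultimately show ?thesis using arcs unfolding embeds_def by blast
qed

section \<open>Distance layers\<close>

text \<open>
  Connectedness is used only through the distances from one fixed vertex.
\<close>

locale rooted_graph = pair_graph G for G :: "'a pair_pre_digraph" +
  fixes r :: 'a
  assumes root: "r \<in> pverts G"
    and reach: "v \<in> pverts G \<Longrightarrow> (r, v) \<in> (parcs G)\<^sup>*"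
begin

definition depth :: "'a \<Rightarrow> nat" where
  "depth v = (LEAST k. (r, v) \<in> parcs G ^^ k)"

definition layer :: "nat \<Rightarrow> 'a set" where
  "layer k = {v \<in> pverts G. depth v = k}"

lemma depth_path: "v \<in> pverts G \<Longrightarrow> (r, v) \<in> parcs G ^^ depth v"
  unfolding depth_def using reach[of v] by (auto simp: rtrancl_power intro: LeastI)

lemma depth_le: "(r, v) \<in> parcs G ^^ k \<Longrightarrow> depth v \<le> k"
  unfolding depth_def by (rule Least_le)

lemma depth_arc:
  assumes "(v, w) \<in> parcs G"
  shows "depth w \<le> Suc (depth v)"
  using depth_path[OF in_arcsD1[OF assms]] assms by (intro depth_le) auto

lemma depth_eq_0: "v \<in> pverts G \<Longrightarrow> depth v = 0 \<Longrightarrow> v = r"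
  using depth_path[of v] by auto

definition parent :: "'a \<Rightarrow> 'a" where
  "parent v = (SOME p. (p, v) \<in> parcs G \<and> Suc (depth p) = depth v)"

lemma parent:
  assumes "v \<in> pverts G" and "0 < depth v"
  shows "(parent v, v) \<in> parcs G" and "Suc (depth (parent v)) = depth v"
proof -
  obtain k where k: "depth v = Suc k" using assms(2) gr0_implies_Suc by blast
  then obtain p where p: "(r, p) \<in> parcs G ^^ k" "(p, v) \<in> parcs G"
    using depth_path[OF assms(1)] by auto
  then have "Suc (depth p) = depth v"
    using depth_le[OF p(1)] depth_arc[OF p(2)] k by simp
  with p(2) have "\<exists>p. (p, v) \<in> parcs G \<and> Suc (depth p) = depth v" by blast
  from someI_ex[OF this] show "(parent v, v) \<in> parcs G" "Suc (depth (parent v)) = depth v"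
    by (simp_all add: parent_def)
qed

abbreviation ancestor :: "nat \<Rightarrow> 'a \<Rightarrow> 'a" where
  "ancestor k \<equiv> parent ^^ k"

lemma ancestor_layer:
  assumes "v \<in> layer i" and "k \<le> i"
  shows "ancestor k v \<in> layer (i - k)"
  using assms(2)
proof (induction k)
  case (Suc k)
  then have "ancestor k v \<in> pverts G" "depth (ancestor k v) = i - k" by (auto simp: layer_def)
  with parent[of "ancestor k v"] in_arcsD1 Suc.prems show ?case by (auto simp: layer_def)
qed (use assms in simp)

lemma ancestor_arc:
  assumes "v \<in> layer i" and "k < i"
  shows "(ancestor (Suc k) v, ancestor k v) \<in> parcs G"
  using ancestor_layer[OF assms(1), of k] assms(2) parent(1)[of "ancestor k v"]
  by (simp add: layer_def)

lemma ancestor_top: "v \<in> layer i \<Longrightarrow> ancestor i v = r"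
  using ancestor_layer[of v i i] depth_eq_0 by (simp add: layer_def)

lemma ancestor_eq_up:
  assumes "ancestor s v = ancestor s w" and "s \<le> t"
  shows "ancestor t v = ancestor t w"
proof -
  have "ancestor (t - s + s) v = ancestor (t - s + s) w"
    unfolding funpow_add comp_def assms(1) ..
  then show ?thesis using assms(2) by simp
qed

text \<open>
  The number of steps after which the lines of ancestors of two vertices merge; it is meaningful
  for vertices of the same layer, whose lines all end in the root.
\<close>

definition meeting :: "'a \<Rightarrow> 'a \<Rightarrow> nat" where
  "meeting v w = (LEAST s. ancestor s v = ancestor s w)"

lemma meeting_commute: "meeting v w = meeting w v"
  unfolding meeting_def by (simp only: eq_commute)

lemma meeting:
  assumes "v \<in> layer i" and "w \<in> layer i"
  shows "ancestor (meeting v w) v = ancestor (meeting v w) w" and "meeting v w \<le> i"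
proof -
  have top: "ancestor i v = ancestor i w" using assms by (simp add: ancestor_top)
  show "ancestor (meeting v w) v = ancestor (meeting v w) w"
    unfolding meeting_def by (rule LeastI[of "\<lambda>s. ancestor s v = ancestor s w", OF top])
  show "meeting v w \<le> i"
    unfolding meeting_def by (rule Least_le[of "\<lambda>s. ancestor s v = ancestor s w", OF top])
qed

lemma before_meeting: "s < meeting v w \<Longrightarrow> ancestor s v \<noteq> ancestor s w"
  unfolding meeting_def by (rule not_less_Least)

lemma meeting_greater:
  assumes "v \<in> layer i" and "w \<in> layer i" and "ancestor n v \<noteq> ancestor n w"
  shows "n < meeting v w"
  using ancestor_eq_up[OF meeting(1)[OF assms(1,2)], of n] assms(3) by (meson not_less)

text \<open>
  The centre is the vertex where the lines of \<open>a\<close> and \<open>b\<close> merge, which happens at least as early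
  as either of them merges with the line of \<open>c\<close>. Two legs run down the lines of \<open>a\<close> and \<open>b\<close>. The
  third leg goes up until it reaches the line of \<open>c\<close> and then runs down along it; the way down alone
  has more than \<open>n\<close> steps, so this leg is long enough even when the centre is close to the root.
  Legs can only meet at equal depth, so disjointness reduces to the lines being apart
  before they merge.
\<close>

lemma three_branches_embedding:
  assumes layer: "a \<in> layer i" "b \<in> layer i" "c \<in> layer i"
    and "0 < n" and n: "n < meeting a b"
    and first: "meeting a b \<le> meeting a c" "meeting a b \<le> meeting b c"
  shows "\<exists>f. embeds f (three_paths n n n) G"
proof -
  define s where "s = meeting a b"
  define t where "t = meeting a c"
  have ineq: "n < s" "s \<le> t" "t \<le> i" "s \<le> i"
    using n first meeting(2) layer by (auto simp: s_def t_def)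
  have ab: "ancestor s a = ancestor s b" and ac: "ancestor t a = ancestor t c"
    using meeting(1) layer by (auto simp: s_def t_def)
  have sep: "\<And>k. k < s \<Longrightarrow> ancestor k a \<noteq> ancestor k b" "\<And>k. k < t \<Longrightarrow> ancestor k a \<noteq> ancestor k c"
    "\<And>k. k < s \<Longrightarrow> ancestor k b \<noteq> ancestor k c"
    using before_meeting first by (auto simp: s_def t_def)
  \<comment> \<open>the depth of an ancestor determines how many steps it was away\<close>
  have height: "k = l" if "ancestor k v = ancestor l w" "k \<le> i" "l \<le> i" "v \<in> layer i" "w \<in> layer i"
    for k l v w
    using that ancestor_layer[of v i k] ancestor_layer[of w i l] by (auto simp: layer_def)
  \<comment> \<open>two branches descend to \<open>a\<close> and \<open>b\<close>; the third climbs until it meets the line of \<open>c\<close>,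
    and then descends towards \<open>c\<close>\<close>
  define \<beta> where "\<beta> = (\<lambda>(k::nat) j. if k = 0 then ancestor (s - j) a else if k = 1 then ancestor (s - j) b
    else if j \<le> t - s then ancestor (s + j) a else ancestor (2 * t - s - j) c)"
  have down_arc: "(ancestor k v, ancestor (k - 1) v) \<in> parcs G" if "v \<in> layer i" "0 < k" "k \<le> i" for v k
    using ancestor_arc[OF that(1), of "k - 1"] that by simp
  have rep: "\<exists>l v. \<beta> k j = ancestor l v \<and> l \<le> i \<and> v \<in> layer i
      \<and> (k = 0 \<and> v = a \<and> l = s - j \<or> k = 1 \<and> v = b \<and> l = s - j
       \<or> k = 2 \<and> v = a \<and> l = s + j \<and> j \<le> t - s \<or> k = 2 \<and> v = c \<and> l = 2 * t - s - j \<and> t - s < j)"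
    if "k < 3" for k j
  proof -
    from that consider "k = 0" | "k = 1" | "k = 2" "j \<le> t - s" | "k = 2" "t - s < j" by linarith
    then show ?thesis
    proof cases
      case 1 then show ?thesis using layer ineq by (intro exI[of _ "s - j"] exI[of _ a]) (simp add: \<beta>_def)
    next
      case 2 then show ?thesis using layer ineq by (intro exI[of _ "s - j"] exI[of _ b]) (simp add: \<beta>_def)
    next
      case 3 then show ?thesis using layer ineq by (intro exI[of _ "s + j"] exI[of _ a]) (simp add: \<beta>_def)
    next
      case 4 then show ?thesis using layer ineq
        by (intro exI[of _ "2 * t - s - j"] exI[of _ c]) (simp add: \<beta>_def)
    qed
  qed
  have "embeds (\<lambda>(k, j). \<beta> k j) (three_paths n n n) G"
  proof (rule three_paths_embedding[OF \<open>0 < n\<close> _ _ _ _ pair_graph])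
    show "\<beta> k 0 = ancestor s a" if "k < 3" for k
      using ab by (simp add: \<beta>_def)
    show "(\<beta> k j, \<beta> k (Suc j)) \<in> parcs G" if "k < 3" "j < n" for k j
    proof -
      from \<open>k < 3\<close> consider "k = 0" | "k = 1" | "k = 2" "Suc j \<le> t - s" | "k = 2" "t - s \<le> j" by linarith
      then show ?thesis
      proof cases
        case 1
        then show ?thesis using down_arc[OF layer(1), of "s - j"] that ineq by (simp add: \<beta>_def)
      next
        case 2
        then show ?thesis using down_arc[OF layer(2), of "s - j"] that ineq by (simp add: \<beta>_def)
      next
        case 3
        then show ?thesis
          using arcs_symmetric[OF ancestor_arc[OF layer(1), of "s + j"]] ineq by (simp add: \<beta>_def)
      next
        case 4
        have "\<beta> k j = ancestor (2 * t - s - j) c"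
        proof (cases "j = t - s")
          case True
          then have "s + j = t" "2 * t - s - j = t" using ineq by auto
          then show ?thesis using 4 True ac by (simp add: \<beta>_def)
        qed (use 4 in \<open>simp add: \<beta>_def\<close>)
        then show ?thesis
          using 4 down_arc[OF layer(3), of "2 * t - s - j"] that ineq by (simp add: \<beta>_def)
      qed
    qed
    show "\<beta> k j \<noteq> ancestor s a" if kj: "k < 3" "0 < j" "j \<le> n" for k j
    proof
      assume eq: "\<beta> k j = ancestor s a"
      obtain l v where lv: "\<beta> k j = ancestor l v" "l \<le> i" "v \<in> layer i"
        "k = 0 \<and> v = a \<and> l = s - j \<or> k = 1 \<and> v = b \<and> l = s - j
         \<or> k = 2 \<and> v = a \<and> l = s + j \<and> j \<le> t - s \<or> k = 2 \<and> v = c \<and> l = 2 * t - s - j \<and> t - s < j"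
        using rep[OF kj(1), of j] by blast
      have "l = s" using height[of l v s a] eq lv layer ineq by simp
      with lv(4) kj ineq have "v = c" "s < t" by auto
      then show False using sep(2)[of s] eq lv(1) \<open>l = s\<close> by simp
    qed
    show "k = k' \<and> j = j'"
      if "k < 3" "k' < 3" "0 < j" "0 < j'" "j \<le> n" "j' \<le> n" and eq: "\<beta> k j = \<beta> k' j'" for k j k' j'
    proof -
      obtain l v where lv: "\<beta> k j = ancestor l v" "l \<le> i" "v \<in> layer i"
        "k = 0 \<and> v = a \<and> l = s - j \<or> k = 1 \<and> v = b \<and> l = s - j
         \<or> k = 2 \<and> v = a \<and> l = s + j \<and> j \<le> t - s \<or> k = 2 \<and> v = c \<and> l = 2 * t - s - j \<and> t - s < j"
        using rep[OF \<open>k < 3\<close>, of j] by blast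
      obtain l' v' where lv': "\<beta> k' j' = ancestor l' v'" "l' \<le> i" "v' \<in> layer i"
        "k' = 0 \<and> v' = a \<and> l' = s - j' \<or> k' = 1 \<and> v' = b \<and> l' = s - j'
         \<or> k' = 2 \<and> v' = a \<and> l' = s + j' \<and> j' \<le> t - s
         \<or> k' = 2 \<and> v' = c \<and> l' = 2 * t - s - j' \<and> t - s < j'"
        using rep[OF \<open>k' < 3\<close>, of j'] by blast
      have l: "l' = l" using height[of l v l' v'] eq lv lv' by simp
      have anc: "ancestor l v = ancestor l v'" using eq lv(1) lv'(1) l by simp
      have dist: "a \<noteq> b" "a \<noteq> c" "b \<noteq> c"
        using sep(1)[of 0] sep(2)[of 0] sep(3)[of 0] ineq by auto
      have "l < s" if "v = b \<or> v' = b"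
      proof -
        have "l = s - j \<or> l = s - j'" using that lv(4) lv'(4) l dist by blast
        then show ?thesis using \<open>0 < j\<close> \<open>0 < j'\<close> ineq by auto
      qed
      moreover have "l < t" if "v = c \<or> v' = c"
      proof -
        have "l = 2 * t - s - j \<and> t - s < j \<or> l = 2 * t - s - j' \<and> t - s < j'"
          using that lv(4) lv'(4) l dist by blast
        then show ?thesis using ineq by arith
      qed
      moreover have "v \<in> {a, b, c}" "v' \<in> {a, b, c}" using lv(4) lv'(4) by blast+
      ultimately have "v = v'" using anc sep[of l] sep(1,2,3)[of l, THEN not_sym] by blast
      then consider "v = a" "v' = a" | "v = b" "v' = b" | "v = c" "v' = c"
        using \<open>v \<in> {a, b, c}\<close> by blast
      then show ?thesis
      proof cases
        case 1
        then have "k = 0 \<and> l = s - j \<or> k = 2 \<and> l = s + j" "k' = 0 \<and> l = s - j' \<or> k' = 2 \<and> l = s + j'"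
          using lv(4) lv'(4) l dist by blast+
        then show ?thesis using ineq \<open>j \<le> n\<close> \<open>j' \<le> n\<close> \<open>0 < j\<close> \<open>0 < j'\<close> by arith
      next
        case 2
        then have "k = 1 \<and> l = s - j" "k' = 1 \<and> l = s - j'" using lv(4) lv'(4) l dist by blast+
        then show ?thesis using ineq \<open>j \<le> n\<close> \<open>j' \<le> n\<close> by arith
      next
        case 3
        then have "k = 2 \<and> l = 2 * t - s - j" "k' = 2 \<and> l = 2 * t - s - j'"
          using lv(4) lv'(4) l dist by blast+
        then show ?thesis using ineq \<open>j \<le> n\<close> \<open>j' \<le> n\<close> by arith
      qed
    qed
  qed
  then show ?thesis by blast
qed

text \<open>
  Among three vertices with different \<open>n\<close>-th ancestors, some pair merges first, which puts the
  vertices in the position of the preceding lemma.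
\<close>

lemma card_ancestors_le_2:
  assumes no_embedding: "\<nexists>f. embeds f (three_paths n n n) G" and "0 < n"
  shows "card (ancestor n ` layer i) \<le> 2"
proof (rule ccontr)
  assume "\<not> ?thesis"
  then have "3 \<le> card (ancestor n ` layer i)" by simp
  then obtain T where "T \<subseteq> ancestor n ` layer i" "card T = 3" by (metis obtain_subset_with_card_n)
  then obtain a b c where abc: "a \<in> layer i" "b \<in> layer i" "c \<in> layer i"
    "ancestor n a \<noteq> ancestor n b" "ancestor n a \<noteq> ancestor n c" "ancestor n b \<noteq> ancestor n c"
    unfolding card_3_iff by blast
  have later: "n < meeting a b" "n < meeting a c" "n < meeting b c"
    using abc by (auto intro: meeting_greater)
  consider "meeting a b \<le> meeting a c" "meeting a b \<le> meeting b c"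
    | "meeting a c \<le> meeting a b" "meeting a c \<le> meeting c b"
    | "meeting b c \<le> meeting b a" "meeting b c \<le> meeting c a"
    using meeting_commute[of a b] meeting_commute[of b c] meeting_commute[of a c] by linarith
  then have "\<exists>f. embeds f (three_paths n n n) G"
  proof cases
    case 1 then show ?thesis using three_branches_embedding[of a i b c n] abc later \<open>0 < n\<close> by blast
  next
    case 2 then show ?thesis using three_branches_embedding[of a i c b n] abc later \<open>0 < n\<close> by blast
  next
    case 3 then show ?thesis using three_branches_embedding[of b i c a n] abc later \<open>0 < n\<close> by blast
  qed
  with no_embedding show False by blast
qed

context
  fixes \<Delta> :: nat
  assumes degree: "\<And>v. v \<in> pverts G \<Longrightarrow> card {w. (v, w) \<in> parcs G} \<le> \<Delta>"
begin

lemma card_neighbours_Un_le: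
  assumes "S \<subseteq> pverts G"
  shows "card (\<Union>v\<in>S. {w. (v, w) \<in> parcs G}) \<le> card S * \<Delta>"
proof -
  have fin: "finite S" using assms pair_finite_verts finite_subset by blast
  have "card (\<Union>v\<in>S. {w. (v, w) \<in> parcs G}) \<le> (\<Sum>v\<in>S. card {w. (v, w) \<in> parcs G})"
    by (rule card_UN_le[OF fin])
  also have "\<dots> \<le> (\<Sum>v\<in>S. \<Delta>)" using assms degree by (intro sum_mono) auto
  finally show ?thesis by simp
qed

text \<open>
  Every vertex has at most \<open>\<Delta>\<close> children, so each of the \<open>n\<close> steps costs a factor \<open>\<Delta>\<close>.
\<close>

lemma card_le_card_ancestors:
  assumes "B \<subseteq> layer i" and "n \<le> i"
  shows "card B \<le> card (ancestor n ` B) * \<Delta> ^ n"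
  using assms
proof (induction n arbitrary: B i)
  case (Suc n)
  then obtain k where i: "i = Suc k" using Suc_le_D by blast
  have par: "parent v \<in> layer k" "(parent v, v) \<in> parcs G" if "v \<in> B" for v
    using that Suc.prems(1) i parent[of v] in_arcsD1 by (auto simp: layer_def)
  have sub: "parent ` B \<subseteq> pverts G" using par by (auto simp: layer_def)
  have "B \<subseteq> (\<Union>p\<in>parent ` B. {w. (p, w) \<in> parcs G})" using par by auto
  moreover have "(\<Union>p\<in>parent ` B. {w. (p, w) \<in> parcs G}) \<subseteq> pverts G" using in_arcsD2 by auto
  ultimately have "card B \<le> card (\<Union>p\<in>parent ` B. {w. (p, w) \<in> parcs G})"
    by (intro card_mono finite_subset[OF _ pair_finite_verts])
  also have "\<dots> \<le> card (parent ` B) * \<Delta>" by (rule card_neighbours_Un_le[OF sub])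
  also have "card (parent ` B) \<le> card (ancestor n ` parent ` B) * \<Delta> ^ n"
    using par Suc.prems i by (intro Suc.IH[of _ k]) auto
  also have "ancestor n ` parent ` B = ancestor (Suc n) ` B"
    by (simp add: image_image funpow_swap1)
  finally show ?case by (simp add: mult_ac)
qed simp

lemma card_layer_le_power: "card (layer i) \<le> \<Delta> ^ i"
proof -
  have "card (ancestor i ` layer i) \<le> card {r}"
    using ancestor_top by (intro card_mono) auto
  then have "card (ancestor i ` layer i) * \<Delta> ^ i \<le> 1 * \<Delta> ^ i" by (intro mult_le_mono1) simp
  with card_le_card_ancestors[OF subset_refl, of i i] show ?thesis by linarith
qed

text \<open>
  This is what excluding the spider buys: a bound on all distance layers independent of the size
  of the graph. Near the root the trivial bound by powers of \<open>\<Delta>\<close> is good enough.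
\<close>

lemma card_layer_le:
  assumes "\<nexists>f. embeds f (three_paths n n n) G" and "0 < n" and "0 < \<Delta>"
  shows "card (layer i) \<le> 2 * \<Delta> ^ n"
proof (cases "n \<le> i")
  case True
  have "card (layer i) \<le> card (ancestor n ` layer i) * \<Delta> ^ n"
    by (rule card_le_card_ancestors[OF subset_refl True])
  also have "\<dots> \<le> 2 * \<Delta> ^ n"
    using card_ancestors_le_2[OF assms(1,2)] by (intro mult_le_mono1)
  finally show ?thesis .
next
  case False
  then have "\<Delta> ^ i \<le> \<Delta> ^ n" using assms(3) by (intro power_increasing) auto
  then show ?thesis using card_layer_le_power[of i] by linarith
qed

end
end

context rooted_graph
begin

lemma closed_under_arcs_eq_pverts:
  assumes "Z \<subseteq> pverts G" and "Z \<noteq> {}"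
    and closed: "\<And>v w. v \<in> Z \<Longrightarrow> (v, w) \<in> parcs G \<Longrightarrow> w \<in> Z"
  shows "Z = pverts G"
proof
  obtain z where z: "z \<in> Z" using assms(2) by blast
  have propagate: "y \<in> Z" if "(x, y) \<in> (parcs G)\<^sup>*" "x \<in> Z" for x y
    using that(1) by (induction rule: rtrancl_induct) (fact that(2), erule (1) closed)
  have "sym (parcs G)" using arcs_symmetric by (intro symI)
  moreover have "(r, z) \<in> (parcs G)\<^sup>*" using reach z assms(1) by blast
  ultimately have "(z, r) \<in> (parcs G)\<^sup>*" by (meson sym_rtrancl symD)
  then have "r \<in> Z" using z by (rule propagate)
  then show "pverts G \<subseteq> Z" using propagate[OF reach] by blast
qed (rule assms(1))

end

section \<open>The multiplicity bound\<close>

theorem theorem3: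
  fixes lam :: real and \<Delta> :: nat and G :: "'a pair_pre_digraph"
  assumes "lam < 3 / sqrt 2"
    and "0 < \<Delta>"
    and "pair_graph G"
    and "Digraph_Component.connected (with_proj G)"
    and "2 \<le> card (pverts G)"
    and "graph_eigenvalue G 2 \<le> lam"
    and "max_degree G \<le> \<Delta>"
  shows "eigenvalue_multiplicity G (graph_eigenvalue G 2)
    \<le> 2 * n_lambda lam * \<Delta> ^ (n_lambda lam + 3) * (1 + \<Delta> + \<Delta>^2)"
proof -
  interpret pair_graph G by fact
  obtain r where r: "r \<in> pverts G" using assms(5) by fastforce
  interpret rooted_graph G r
  proof unfold_locales
    fix v assume "v \<in> pverts G"
    with assms(4) r have "(r, v) \<in> rtrancl_on (pverts G) (parcs (mk_symmetric (with_proj G)))"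
      by (simp add: Digraph_Component.connected_def strongly_connected_def reachable_def)
    moreover have "parcs (mk_symmetric (with_proj G)) = parcs G"
      using adj_mk_symmetric_eq pair_sym_arcs by simp
    ultimately show "(r, v) \<in> (parcs G)\<^sup>*"
      by (induction rule: rtrancl_on_induct) (auto intro: rtrancl_into_rtrancl)
  qed (rule r)
  interpret symmetric_kernel "pverts G" "adjacency G"
    by (rule adjacency_symmetric_kernel[OF assms(3)])
  have degree: "card {w. (v, w) \<in> parcs G} \<le> \<Delta>" if "v \<in> pverts G" for v
  proof -
    have "out_arcs (with_proj G) v = Pair v ` {w. (v, w) \<in> parcs G}"
      by (auto simp: out_arcs_def)
    then have "card {w. (v, w) \<in> parcs G} = out_degree (with_proj G) v"
      by (simp add: out_degree_def card_image inj_on_def)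
    also have "\<dots> \<le> max_degree G"
      unfolding max_degree_def using that pair_finite_verts by (intro Max_ge) auto
    finally show ?thesis using assms(7) by simp
  qed

  obtain u d where basis: "eigenbasis (card (pverts G)) u d" using eigenbasis_exists by blast
  define \<mu> where "\<mu> = d 1"
  have N: "1 < card (pverts G)" using assms(5) by simp
  have second: "graph_eigenvalue G 2 = \<mu>"
    using graph_eigenvalue_eigenbasis[OF assms(3) basis, of 2] assms(5) by (simp add: \<mu>_def)
  define m where "m = eigenvalue_multiplicity G \<mu>"
  note cases = form_le_separated_cases[OF basis N, folded \<mu>_def]
  have mult: "m \<le> card Y" if "form_le \<mu> (pverts G - S)" "Y \<subseteq> pverts G" "Y \<noteq> {}" "S \<subseteq> Y"
    "\<And>v w. v \<in> S \<Longrightarrow> (v, w) \<in> parcs G \<Longrightarrow> w \<in> Y" for S Y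
    unfolding m_def eigenvalue_multiplicity_eigenbasis[OF assms(3) basis]
  proof (rule multiplicity_le_card[OF _ basis _ that(1-4)])
    show "Z = pverts G" if "Z \<subseteq> pverts G" "Z \<noteq> {}"
      "\<And>v w. v \<in> Z \<Longrightarrow> w \<in> pverts G \<Longrightarrow> adjacency G v w \<noteq> 0 \<Longrightarrow> w \<in> Z" for Z
      using that in_arcsD2 by (intro closed_under_arcs_eq_pverts) auto
  qed (use that(5) in \<open>auto split: if_splits\<close>)

  define n where "n = n_lambda lam"
  have n: "0 < n" "\<mu> < graph_eigenvalue (three_paths n n n) 1"
    using n_lambda[OF assms(1)] assms(6) second by (auto simp: n_def)
  define q where "q = 1 + \<Delta> + \<Delta>\<^sup>2"
  have "m \<le> 2 * n * \<Delta> ^ (n + 3) * q"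
  proof (cases "\<exists>f. embeds f (three_paths n n n) G")
    case True
    then obtain f where f: "embeds f (three_paths n n n) G" by blast
    \<comment> \<open>delete the spider and its neighbours: its form exceeds \<open>\<mu>\<close>, so the rest stays below\<close>
    define H where "H = f ` pverts (three_paths n n n)"
    define nbrs where "nbrs = (\<lambda>S. \<Union>v\<in>S. {w. (v, w) \<in> parcs G})"
    define S where "S = H \<union> nbrs H"
    define Y where "Y = S \<union> nbrs S"
    have nbrs_sub: "nbrs A \<subseteq> pverts G" for A using in_arcsD2 by (auto simp: nbrs_def)
    have H_sub: "H \<subseteq> pverts G" using f by (simp add: embeds_def H_def)
    then have subs: "S \<subseteq> pverts G" "Y \<subseteq> pverts G" using nbrs_sub by (auto simp: S_def Y_def)
    have "pverts (three_paths n n n) \<noteq> {}" by (simp add: pverts_three_paths)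
    then have "H \<noteq> {}" "\<not> form_le \<mu> H"
      using embedding_not_form_le[OF three_paths_pair_graph assms(3) _ f n(2)] by (auto simp: H_def)
    moreover have "separated H (pverts G - S)"
      by (auto simp: separated_def S_def nbrs_def)
    ultimately have "form_le \<mu> (pverts G - S)" using cases by blast
    then have "m \<le> card Y"
      using subs \<open>H \<noteq> {}\<close> by (intro mult) (auto simp: Y_def S_def nbrs_def)
    also have "\<dots> \<le> card S * (1 + \<Delta>)"
      using card_Un_le[of S "nbrs S"] card_neighbours_Un_le[OF degree subs(1)]
      by (simp add: Y_def nbrs_def)
    also have "\<dots> \<le> card H * (1 + \<Delta>) * (1 + \<Delta>)"
      using card_Un_le[of H "nbrs H"] card_neighbours_Un_le[OF degree H_sub]
      by (intro mult_le_mono1) (simp add: S_def nbrs_def)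
    also have "\<dots> \<le> 4 * n * (1 + \<Delta>) * (1 + \<Delta>)"
    proof -
      have "card H \<le> 3 * n + 1"
        unfolding H_def card_pverts_three_paths[symmetric]
        by (rule card_image_le) (simp add: pverts_three_paths)
      then show ?thesis using n(1) by (intro mult_le_mono1) simp
    qed
    also have "\<dots> \<le> 4 * n * (2 * q)"
      unfolding mult.assoc by (intro mult_le_mono2) (simp add: q_def power2_eq_square)
    also have "\<dots> = 2 * n * 4 * q" by simp
    also have "\<dots> \<le> 2 * n * \<Delta> ^ (n + 3) * q"
    proof -
      \<comment> \<open>the centre of the spider has several neighbours, so the power of \<open>\<Delta>\<close> absorbs the factor \<open>4\<close>\<close>
      have "2 \<le> \<Delta>"
      proof -
        let ?c = "path_vertex 0 0" and ?v = "path_vertex 0 1" and ?w = "path_vertex 1 1"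
        have arcs: "(?c, ?v) \<in> parcs (three_paths n n n)" "(?c, ?w) \<in> parcs (three_paths n n n)"
          using n(1) by (auto simp: parcs_three_paths path_vertex_def intro!: image_eqI[of _ _ "(_, 0)"])
        have "?v \<noteq> ?w" by (simp add: path_vertex_def)
        moreover have "?v \<in> pverts (three_paths n n n)" "?w \<in> pverts (three_paths n n n)"
          using n(1) by (auto intro: path_vertex_in_three_paths)
        ultimately have "f ?v \<noteq> f ?w" using f by (auto simp: embeds_def inj_on_def)
        then have "2 = card {f ?v, f ?w}" by simp
        also have "\<dots> \<le> card {w. (f ?c, w) \<in> parcs G}"
        proof (rule card_mono)
          show "finite {w. (f ?c, w) \<in> parcs G}"
            by (rule finite_subset[OF _ pair_finite_verts]) (use in_arcsD2 in auto)
          show "{f ?v, f ?w} \<subseteq> {w. (f ?c, w) \<in> parcs G}"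
            using f arcs unfolding embeds_def by blast
        qed
        also have "\<dots> \<le> \<Delta>"
          using f path_vertex_in_three_paths[of 0 0 n] by (intro degree) (auto simp: embeds_def)
        finally show ?thesis .
      qed
      have "4 = (2::nat) ^ 2" by simp
      also have "\<dots> \<le> \<Delta> ^ 2" using \<open>2 \<le> \<Delta>\<close> by (intro power_mono) auto
      also have "\<dots> \<le> \<Delta> ^ (n + 3)" using \<open>2 \<le> \<Delta>\<close> by (intro power_increasing) auto
      finally show ?thesis by (intro mult_le_mono) auto
    qed
    finally show ?thesis .
  next
    case no_embedding: False
    \<comment> \<open>grow a ball around \<open>r\<close> until its largest eigenvalue exceeds \<open>\<mu>\<close>, and cut there\<close>
    define U where "U = (\<lambda>k. {v \<in> pverts G. depth v < k})"
    show ?thesis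
    proof (cases "form_le \<mu> (pverts G)")
      case True
      \<comment> \<open>nothing has to be deleted: zeros of a nonnegative eigenvector spread from a single vertex\<close>
      then have "m \<le> card {r}" using r by (intro mult[of "{}" "{r}"]) auto
      also have "\<dots> \<le> 2 * n * \<Delta> ^ (n + 3) * q"
        using n(1) assms(2) by (simp add: q_def Suc_le_eq)
      finally show ?thesis .
    next
      case False
      have "U (Suc (Max (depth ` pverts G))) = pverts G"
        using pair_finite_verts by (auto simp: U_def less_Suc_eq_le)
      with False have ex: "\<exists>k. \<not> form_le \<mu> (U k)" by metis
      define k where "k = (LEAST k. \<not> form_le \<mu> (U k))"
      have k: "\<not> form_le \<mu> (U k)" unfolding k_def by (rule LeastI_ex[OF ex])
      \<comment> \<open>the balls are open: \<open>U 0\<close> is empty, so its bound holds even if \<open>\<mu>\<close> is negative\<close>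
      have "form_le \<mu> (U 0)" by (auto simp: form_le_def U_def dot_def)
      with k have "k \<noteq> 0" by metis
      then obtain j where j: "k = Suc j" using not0_implies_Suc by blast
      have below: "form_le \<mu> (U j)" 
        using not_less_Least[of j "\<lambda>k. \<not> form_le \<mu> (U k)"] j unfolding k_def by simp
      define W where "W = {v \<in> pverts G. j + 2 \<le> depth v}"
      have sep: "separated (U (Suc j)) W" "separated (U j) W"
        using depth_arc by (fastforce simp: separated_def U_def W_def)+
      have "form_le \<mu> W" using cases[OF sep(1)] k j by blast
      then have "form_le \<mu> (U j \<union> W)" by (rule form_le_union[OF sep(2) below])
      moreover define S where "S = layer j \<union> layer (j + 1)"
      have "U j \<union> W = pverts G - S" by (auto simp: S_def U_def W_def layer_def)
      ultimately have le: "form_le \<mu> (pverts G - S)" by simp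
      \<comment> \<open>for \<open>j = 0\<close>, truncated subtraction makes \<open>layer (j - 1)\<close> a part of \<open>S\<close>\<close>
      define Y where "Y = S \<union> layer (j - 1) \<union> layer (j + 2)"
      have "layer j \<noteq> {}"
      proof
        assume "layer j = {}"
        then have "U (Suc j) = U j" by (auto simp: U_def layer_def less_Suc_eq)
        then show False using k j below by simp
      qed
      moreover have "w \<in> Y" if "v \<in> S" "(v, w) \<in> parcs G" for v w
      proof -
        have "depth w \<le> Suc (depth v)" "depth v \<le> Suc (depth w)" "w \<in> pverts G"
          using depth_arc arcs_symmetric in_arcsD2 that(2) by blast+
        moreover have "depth v = j \<or> depth v = j + 1" using that(1) by (auto simp: S_def layer_def)
        ultimately show ?thesis unfolding Y_def S_def layer_def by (simp, arith)
      qed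
      ultimately have "m \<le> card Y"
        by (intro mult[OF le]) (auto simp: Y_def S_def layer_def)
      also have "\<dots> \<le> card (layer j) + card (layer (j + 1)) + card (layer (j - 1)) + card (layer (j + 2))"
        using card_Un_le[of "layer j" "layer (j + 1)"] card_Un_le[of S "layer (j - 1)"]
          card_Un_le[of "S \<union> layer (j - 1)" "layer (j + 2)"]
        unfolding Y_def S_def by linarith
      finally have m: "m \<le> card (layer j) + card (layer (j + 1)) + card (layer (j - 1)) + card (layer (j + 2))" .
      show ?thesis
      \<comment> \<open>for \<open>\<Delta> = n = 1\<close> the claimed bound is \<open>6\<close>, less than four times \<open>2 * \<Delta> ^ n\<close>\<close>
      proof (cases "\<Delta> = 1")
        case True
        then have layers: "card (layer i) \<le> 1" for i using card_layer_le_power[OF degree, of i] by simp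
        have "m \<le> 4"
          using m layers[of j] layers[of "j + 1"] layers[of "j - 1"] layers[of "j + 2"] by linarith
        then show ?thesis using True n(1) by (simp add: q_def)
      next
        case False
        then have "2 \<le> \<Delta>" using assms(2) by simp
        have layers: "card (layer i) \<le> 2 * \<Delta> ^ n" for i
          using card_layer_le[OF degree _ n(1) assms(2)] no_embedding by blast
        have "m \<le> 2 * \<Delta> ^ n * 4"
          using m layers[of j] layers[of "j + 1"] layers[of "j - 1"] layers[of "j + 2"] by linarith
        also have "\<dots> \<le> 2 * (\<Delta> ^ n * \<Delta> ^ 3)"
        proof -
          have "4 \<le> (2::nat) ^ 3" by simp
          also have "\<dots> \<le> \<Delta> ^ 3" using \<open>2 \<le> \<Delta>\<close> by (intro power_mono) auto
          finally show ?thesis by simp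
        qed
        also have "\<dots> = 2 * 1 * \<Delta> ^ (n + 3) * 1" by (simp add: power_add)
        also have "\<dots> \<le> 2 * n * \<Delta> ^ (n + 3) * q"
          using n(1) by (intro mult_le_mono) (auto simp: q_def)
        finally show ?thesis .
      qed
    qed
  qed
  then show ?thesis by (simp add: m_def second n_def q_def)
qed

end
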